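(* Let $E$ be a real or complex Banach lattice and let $u \in E_+$. Suppose that $T \in \mathcal{L}(E)$ and that $TE \subseteq E_u$. Then the following assertions are true. (i) If $E$ has order continuous norm, then $T^2 \in \mathcal{L}(E)$ is compact. (ii) If $E$ is reflexive, then $T \in \mathcal{L}(E)$ is compact.
   Context: $E_+$ denotes the positive cone of the Banach lattice $E$ and $\mathcal{L}(E)$ the space of bounded linear operators on $E$. For $u \in E_+$ the principal ideal generated by $u$ is $E_u := \{f \in E : \exists c \ge 0,\ |f| \le cu\}$. A real Banach lattice has order continuous norm if every downward directed net in it with infimum $0$ converges to $0$ in norm; a complex Banach lattice $E$ has order continuous norm if its real part $E_{\mathbb{R}}$ has order continuous norm. *)

theory Defs
  imports "HOL-Analysis.Analysis" "HOL-Library.Lattice_Algebras"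
begin

section \<open>Real Banach lattices\<close>

class banach_lattice = banach + ordered_real_vector + lattice_ab_group_add_abs +
  assumes norm_mono_abs: "\<bar>x\<bar> \<le> \<bar>y\<bar> \<Longrightarrow> norm x \<le> norm y"

instance real :: banach_lattice
  by standard (auto simp: sup_real_def)

definition is_infimum :: "'a::order set \<Rightarrow> 'a \<Rightarrow> bool" where
  "is_infimum D m \<longleftrightarrow> (\<forall>x\<in>D. m \<le> x) \<and> (\<forall>y. (\<forall>x\<in>D. y \<le> x) \<longrightarrow> y \<le> m)"

definition is_supremum :: "'a::order set \<Rightarrow> 'a \<Rightarrow> bool" where
  "is_supremum D m \<longleftrightarrow> (\<forall>x\<in>D. x \<le> m) \<and> (\<forall>y. (\<forall>x\<in>D. x \<le> y) \<longrightarrow> m \<le> y)"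

definition downward_directed :: "'a::order set \<Rightarrow> bool" where
  "downward_directed D \<longleftrightarrow> D \<noteq> {} \<and> (\<forall>x\<in>D. \<forall>y\<in>D. \<exists>z\<in>D. z \<le> x \<and> z \<le> y)"

text \<open>A downward directed set \<open>D\<close> is regarded as a decreasing net indexed by itself, so that norm
  convergence to \<open>0\<close> refers to the filter of the sections \<open>{x \<in> D. x \<le> d}\<close>. The lemma
  \<open>order_continuous_norm_net\<close> below recovers decreasing nets over arbitrary directed index sets.\<close>

definition order_continuous_norm :: "'a::banach_lattice itself \<Rightarrow> bool" where
  "order_continuous_norm _ \<longleftrightarrow>
     (\<forall>D::'a set. downward_directed D \<and> is_infimum D 0 \<longrightarrow>
        ((\<lambda>x. x) \<longlongrightarrow> 0) (INF d\<in>D. principal {x\<in>D. x \<le> d}))"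

lemma order_continuous_normD:
  fixes D :: "'a::banach_lattice set"
  assumes "order_continuous_norm TYPE('a)" "downward_directed D" "is_infimum D 0" "e > 0"
  shows "\<exists>d\<in>D. \<forall>x\<in>D. x \<le> d \<longrightarrow> norm x < e"
proof -
  have *: "((\<lambda>x. x) \<longlongrightarrow> 0) (INF d\<in>D. principal {x\<in>D. x \<le> d})"
    using assms unfolding order_continuous_norm_def by blast
  have "\<forall>\<^sub>F x in (INF d\<in>D. principal {x\<in>D. x \<le> d}). dist x 0 < e"
    using tendstoD[OF * \<open>e > 0\<close>] .
  then show ?thesis
  proof (subst (asm) eventually_INF_base)
    show "D \<noteq> {}" using assms(2) by (simp add: downward_directed_def)
    fix a b assume "a \<in> D" "b \<in> D"
    then obtain z where "z \<in> D" "z \<le> a" "z \<le> b"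
      using assms(2) unfolding downward_directed_def by blast
    then show "\<exists>x\<in>D. principal {y\<in>D. y \<le> x} \<le> inf (principal {x\<in>D. x \<le> a}) (principal {x\<in>D. x \<le> b})"
      by (intro bexI[of _ z]) auto
  qed (auto simp: eventually_principal)
qed

lemma order_continuous_norm_net:
  fixes X :: "'i \<Rightarrow> 'a::banach_lattice" and I :: "'i set" and r :: "'i \<Rightarrow> 'i \<Rightarrow> bool"
  assumes "order_continuous_norm TYPE('a)"
    and "I \<noteq> {}" "\<And>i j. i \<in> I \<Longrightarrow> j \<in> I \<Longrightarrow> \<exists>k\<in>I. r i k \<and> r j k"
    and "\<And>i j. i \<in> I \<Longrightarrow> j \<in> I \<Longrightarrow> r i j \<Longrightarrow> X j \<le> X i"
    and "is_infimum (X ` I) 0" "e > 0"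
  shows "\<exists>i\<in>I. \<forall>j\<in>I. r i j \<longrightarrow> norm (X j) < e"
proof -
  have "downward_directed (X ` I)"
    unfolding downward_directed_def
  proof (intro conjI ballI)
    fix x y assume "x \<in> X ` I" "y \<in> X ` I"
    then obtain i j where ij: "i \<in> I" "x = X i" "j \<in> I" "y = X j" by blast
    with assms(3) obtain k where "k \<in> I" "r i k" "r j k" by blast
    then show "\<exists>z\<in>X ` I. z \<le> x \<and> z \<le> y"
      using assms(4)[of i k] assms(4)[of j k] ij by (intro bexI[of _ "X k"]) simp_all
  qed (use assms(2) in simp)
  from order_continuous_normD[OF assms(1) this assms(5,6)]
  have "\<exists>i\<in>I. \<forall>j\<in>I. X j \<le> X i \<longrightarrow> norm (X j) < e" by simp
  then obtain i where i: "i \<in> I" "\<And>j. j \<in> I \<Longrightarrow> X j \<le> X i \<Longrightarrow> norm (X j) < e"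
    by auto
  show ?thesis
    by (rule bexI[OF _ i(1)]) (intro ballI impI i(2) assms(4) i(1))
qed

section \<open>Complex Banach lattices\<close>

lemma norm_mono_pos: "0 \<le> x \<Longrightarrow> x \<le> y \<Longrightarrow> norm x \<le> norm (y::'a::banach_lattice)"
  by (rule norm_mono_abs) (simp add: order_trans[of 0 x y])

lemma norm_abs_eq [simp]: "norm \<bar>x\<bar> = norm (x::'a::banach_lattice)"
  by (rule antisym; rule norm_mono_abs) simp_all

lemma banach_lattice_pos_limit:
  fixes X :: "nat \<Rightarrow> 'a::banach_lattice"
  assumes "X \<longlonglongrightarrow> x" "\<And>n. n \<ge> N \<Longrightarrow> 0 \<le> X n"
  shows "0 \<le> x"
proof -
  have le: "norm (sup (- x) 0) \<le> norm (X n - x)" if "n \<ge> N" for n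
  proof (rule norm_mono_abs)
    have "- x \<le> X n - x" using assms(2)[OF that] by simp
    also have "\<dots> \<le> \<bar>X n - x\<bar>" by (rule abs_ge_self)
    finally show "\<bar>sup (- x) 0\<bar> \<le> \<bar>X n - x\<bar>" by simp
  qed
  have "(\<lambda>n. norm (X n - x)) \<longlonglongrightarrow> 0"
    using assms(1) by (simp add: LIM_zero_iff tendsto_norm_zero)
  then have "norm (sup (- x) 0) \<le> 0"
    by (rule LIMSEQ_le_const) (use le in blast)
  then have "sup (- x) 0 = 0" by simp
  then have "- x \<le> 0" by (metis sup_ge1)
  then show ?thesis by simp
qed

lemma banach_lattice_limit_ge:
  fixes X :: "nat \<Rightarrow> 'a::banach_lattice"
  assumes "X \<longlonglongrightarrow> x" "\<And>n. n \<ge> N \<Longrightarrow> a \<le> X n"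
  shows "a \<le> x"
proof -
  have lim: "(\<lambda>n. X n - a) \<longlonglongrightarrow> x - a"
    by (rule tendsto_diff[OF assms(1) tendsto_const])
  have ge: "0 \<le> X n - a" if "n \<ge> N" for n
    unfolding diff_ge_0_iff_ge by (rule assms(2)[OF that])
  show ?thesis
    using banach_lattice_pos_limit[OF lim ge] unfolding diff_ge_0_iff_ge .
qed

lemma banach_lattice_limit_le:
  fixes X :: "nat \<Rightarrow> 'a::banach_lattice"
  assumes "X \<longlonglongrightarrow> x" "\<And>n. n \<ge> N \<Longrightarrow> X n \<le> a"
  shows "x \<le> a"
proof -
  have lim: "(\<lambda>n. a - X n) \<longlonglongrightarrow> a - x"
    by (rule tendsto_diff[OF tendsto_const assms(1)])
  have ge: "0 \<le> a - X n" if "n \<ge> N" for n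
    unfolding diff_ge_0_iff_ge by (rule assms(2)[OF that])
  show ?thesis
    using banach_lattice_pos_limit[OF lim ge] unfolding diff_ge_0_iff_ge .
qed

lemma ex_supremum:
  fixes A :: "'a::banach_lattice set"
  assumes w: "0 \<le> w"
    and fin: "\<And>e::real. e > 0 \<Longrightarrow> \<exists>F. finite F \<and> F \<subseteq> A \<and> F \<noteq> {} \<and> (\<forall>a\<in>A. \<exists>f\<in>F. a \<le> f + e *\<^sub>R w)"
  shows "\<exists>s. is_supremum A s"
proof -
  let ?e = "\<lambda>n::nat. (1/2::real) ^ n"
  let ?P = "\<lambda>n F. finite F \<and> F \<subseteq> A \<and> F \<noteq> {} \<and> (\<forall>a\<in>A. \<exists>f\<in>F. a \<le> f + ?e n *\<^sub>R w)"
  have "\<forall>n. \<exists>F. ?P n F" by (intro allI fin) simp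
  from choice[OF this] obtain F where F0: "\<forall>n. ?P n (F n)" by (rule exE)
  have F: "finite (F n)" "F n \<subseteq> A" "F n \<noteq> {}" "\<forall>a\<in>A. \<exists>f\<in>F n. a \<le> f + ?e n *\<^sub>R w" for n
    using spec[OF F0, of n] by - (elim conjE, assumption)+
  define G where "G n = (\<Union>k\<le>n. F k)" for n
  have G1: "finite (G n)" for n unfolding G_def using F(1) by (intro finite_UN_I) auto
  have G2: "G n \<subseteq> A" for n unfolding G_def using F(2) by (intro UN_least)
  have FG: "F n \<subseteq> G n" for n unfolding G_def by (rule UN_upper) simp
  have G3: "G n \<noteq> {}" for n using FG[of n] F(3)[of n] by auto
  note G = G1 G2 G3
  define s where "s n = Sup_fin (G n)" for n
  have s_up: "a \<le> s n + ?e n *\<^sub>R w" if a: "a \<in> A" for a n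
  proof -
    obtain f where f: "f \<in> F n" "a \<le> f + ?e n *\<^sub>R w" using bspec[OF F(4) a] by blast
    then have "f \<le> s n" unfolding s_def by (intro Sup_fin.coboundedI G subsetD[OF FG])
    then have "f + ?e n *\<^sub>R w \<le> s n + ?e n *\<^sub>R w" by (rule add_right_mono)
    with f(2) show ?thesis by (rule order_trans)
  qed
  have s_le: "s n \<le> b" if "\<And>a. a \<in> A \<Longrightarrow> a \<le> b" for n b
    unfolding s_def by (rule Sup_fin.boundedI[OF G1 G3 that]) (rule subsetD[OF G2])
  have mono: "s n \<le> s m" if "n \<le> m" for n m
    unfolding s_def
    by (rule Sup_fin.subset_imp[OF _ G3 G1]) (use that in \<open>auto simp: G_def intro: order_trans\<close>)
  have close: "norm (s m - s n) \<le> ?e n * norm w" if "n \<le> m" for n m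
  proof -
    have "s m - s n \<le> ?e n *\<^sub>R w" using s_le[OF s_up, of m n] by (simp add: algebra_simps)
    then have "norm (s m - s n) \<le> norm (?e n *\<^sub>R w)"
      by (intro norm_mono_pos) (use mono[OF that] in auto)
    then show ?thesis by simp
  qed
  have e0: "(\<lambda>n. ?e n) \<longlonglongrightarrow> 0" by (rule LIMSEQ_power_zero) simp
  have "(\<lambda>n. ?e n * norm w) \<longlonglongrightarrow> 0" using tendsto_mult_left_zero[OF e0] .
  have "Cauchy s"
  proof (rule metric_CauchyI)
    fix e :: real assume "e > 0"
    then have "\<forall>\<^sub>F n in sequentially. ?e n * norm w < e"
      by (rule order_tendstoD(2)[OF \<open>(\<lambda>n. ?e n * norm w) \<longlonglongrightarrow> 0\<close>])
    then obtain N where N: "\<And>n. n \<ge> N \<Longrightarrow> ?e n * norm w < e"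
      unfolding eventually_sequentially by blast
    have *: "norm (s m - s n) < e" if "N \<le> n" "n \<le> m" for n m
      using close[OF that(2)] N[OF that(1)] by linarith
    show "\<exists>M. \<forall>m\<ge>M. \<forall>n\<ge>M. dist (s m) (s n) < e"
    proof (intro exI[of _ N] allI impI)
      fix m n assume "N \<le> m" "N \<le> n"
      then show "dist (s m) (s n) < e"
        using *[of n m] *[of m n] by (cases n m rule: le_cases) (auto simp: dist_norm norm_minus_commute)
    qed
  qed
  then obtain t where t: "s \<longlonglongrightarrow> t" using Cauchy_convergent convergent_def by blast
  have "is_supremum A t"
    unfolding is_supremum_def
  proof (intro conjI ballI allI impI)
    fix a assume a: "a \<in> A"
    have "(\<lambda>n. s n + ?e n *\<^sub>R w) \<longlonglongrightarrow> t + 0 *\<^sub>R w"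
      by (intro tendsto_add tendsto_scaleR tendsto_const t e0)
    from banach_lattice_limit_ge[OF this s_up[OF a]] show "a \<le> t" by simp
  next
    fix b assume "\<forall>x\<in>A. x \<le> b"
    then have "s n \<le> b" for n by (intro s_le) blast
    from banach_lattice_limit_le[OF t this] show "t \<le> b" .
  qed
  then show ?thesis ..
qed

text \<open>The complexification \<open>x + \<i>y\<close> of a real vector lattice; every complex Banach lattice
  is, by definition, the complexification of its real part.\<close>

datatype 'a complexification = Complexify (re_part: 'a) (im_part: 'a)

lemma complexification_eq_iff:
  "z = w \<longleftrightarrow> re_part z = re_part w \<and> im_part z = im_part w"
  by (cases z; cases w) auto

definition rotations :: "'a::real_vector complexification \<Rightarrow> 'a set" where
  "rotations z = range (\<lambda>\<theta>. cos \<theta> *\<^sub>R re_part z + sin \<theta> *\<^sub>R im_part z)"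

text \<open>\<open>rotations z\<close> consists of the real parts of all \<open>exp(-\<i>\<theta>) z\<close>, so this is the usual
  modulus \<open>\<bar>z\<bar> = sup {Re (exp(\<i>\<theta>) z) | \<theta>}\<close>; the supremum exists by \<open>modulus_supremum\<close>.\<close>

definition modulus :: "'a::banach_lattice complexification \<Rightarrow> 'a" where
  "modulus z = (THE s. is_supremum (rotations z) s)"

lemma is_supremum_unique: "is_supremum A s \<Longrightarrow> is_supremum A t \<Longrightarrow> s = t"
  unfolding is_supremum_def by (blast intro: antisym)

lemma scaleR_le_abs: "c *\<^sub>R x \<le> \<bar>c\<bar> *\<^sub>R \<bar>x::'a::banach_lattice\<bar>"
proof (cases "c \<ge> 0")
  case True then show ?thesis by (simp add: scaleR_left_mono abs_ge_self)
next
  case False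
  then have "(- c) *\<^sub>R (- x) \<le> (- c) *\<^sub>R \<bar>x\<bar>"
    by (intro scaleR_left_mono abs_ge_minus_self) auto
  then show ?thesis using False by simp
qed

lemma ex_rotations_supremum:
  fixes z :: "'a::banach_lattice complexification"
  shows "\<exists>s. is_supremum (rotations z) s"
proof (rule ex_supremum)
  let ?x = "re_part z" and ?y = "im_part z"
  let ?f = "\<lambda>p::real \<times> real. fst p *\<^sub>R ?x + snd p *\<^sub>R ?y"
  let ?S = "range (\<lambda>\<theta>::real. (cos \<theta>, sin \<theta>))"
  show "0 \<le> \<bar>?x\<bar> + \<bar>?y\<bar>" by simp
  fix e :: real assume e: "e > 0"
  have S: "?S = (\<lambda>\<theta>. (cos \<theta>, sin \<theta>)) ` {0..2*pi}"
  proof (intro equalityI subsetI)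
    fix p assume "p \<in> ?S"
    then obtain \<theta> :: real where p: "p = (cos \<theta>, sin \<theta>)" by auto
    have "(cos \<theta>)\<^sup>2 + (sin \<theta>)\<^sup>2 = 1" by simp
    from sincos_total_2pi_le[OF this] p show "p \<in> (\<lambda>\<theta>. (cos \<theta>, sin \<theta>)) ` {0..2*pi}" by force
  qed auto
  have "compact ?S" unfolding S by (intro compact_continuous_image continuous_intros compact_Icc)
  then have "\<exists>K. finite K \<and> K \<subseteq> ?S \<and> ?S \<subseteq> (\<Union>k\<in>K. ball k e)"
    unfolding compact_eq_seq_compact_metric using seq_compact_imp_totally_bounded e by blast
  then obtain K where K: "finite K" "K \<subseteq> ?S" "?S \<subseteq> (\<Union>k\<in>K. ball k e)"
    by (elim exE conjE)
  have rot: "rotations z = ?f ` ?S" unfolding rotations_def by (simp add: image_image)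
  show "\<exists>F. finite F \<and> F \<subseteq> rotations z \<and> F \<noteq> {} \<and>
      (\<forall>a\<in>rotations z. \<exists>f\<in>F. a \<le> f + e *\<^sub>R (\<bar>?x\<bar> + \<bar>?y\<bar>))"
  proof (intro exI[of _ "?f ` K"] conjI ballI)
    show "finite (?f ` K)" using K by simp
    show "?f ` K \<subseteq> rotations z" unfolding rot by (rule image_mono[OF K(2)])
    have "K \<noteq> {}" using K(3) by (cases "K = {}") simp_all
    then show "?f ` K \<noteq> {}" by simp
    fix a assume "a \<in> rotations z"
    then obtain p where p: "p \<in> ?S" "a = ?f p" unfolding rot by blast
    with K(3) have "p \<in> (\<Union>k\<in>K. ball k e)" by (intro subsetD[OF K(3)])
    then obtain k where k: "k \<in> K" "dist k p < e" by auto
    have "dist (fst k) (fst p) \<le> dist k p" "dist (snd k) (snd p) \<le> dist k p"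
      by (rule dist_fst_le, rule dist_snd_le)
    then have d: "\<bar>fst p - fst k\<bar> \<le> e" "\<bar>snd p - snd k\<bar> \<le> e"
      using k by (auto simp: dist_real_def)
    have "?f p - ?f k = (fst p - fst k) *\<^sub>R ?x + (snd p - snd k) *\<^sub>R ?y"
      by (simp add: algebra_simps)
    also have "\<dots> \<le> \<bar>fst p - fst k\<bar> *\<^sub>R \<bar>?x\<bar> + \<bar>snd p - snd k\<bar> *\<^sub>R \<bar>?y\<bar>"
      by (intro add_mono scaleR_le_abs)
    also have "\<dots> \<le> e *\<^sub>R \<bar>?x\<bar> + e *\<^sub>R \<bar>?y\<bar>"
      by (intro add_mono scaleR_right_mono d) auto
    finally have "?f p \<le> ?f k + e *\<^sub>R (\<bar>?x\<bar> + \<bar>?y\<bar>)" by (simp add: algebra_simps)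
    with p k show "\<exists>f\<in>?f ` K. a \<le> f + e *\<^sub>R (\<bar>?x\<bar> + \<bar>?y\<bar>)" by blast
  qed
qed

lemma modulus_supremum: "is_supremum (rotations z) (modulus z)"
  unfolding modulus_def
  by (rule theI') (use ex_rotations_supremum[of z] is_supremum_unique in blast)

lemma rotation_le_modulus: "cos \<theta> *\<^sub>R re_part z + sin \<theta> *\<^sub>R im_part z \<le> modulus z"
  using modulus_supremum[of z] unfolding is_supremum_def rotations_def by blast

lemma modulus_least:
  assumes "\<And>\<theta>. cos \<theta> *\<^sub>R re_part z + sin \<theta> *\<^sub>R im_part z \<le> b"
  shows "modulus z \<le> b"
  using modulus_supremum[of z] assms unfolding is_supremum_def rotations_def by blast

lemma modulus_ge_re: "\<bar>re_part z\<bar> \<le> modulus z"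
  using rotation_le_modulus[of 0 z] rotation_le_modulus[of pi z] by (auto intro: abs_leI)

lemma modulus_ge_im: "\<bar>im_part z\<bar> \<le> modulus z"
  using rotation_le_modulus[of "pi/2" z] rotation_le_modulus[of "- (pi/2)" z] by (auto intro: abs_leI)

lemma modulus_nonneg: "0 \<le> modulus z"
  using modulus_ge_re[of z] abs_ge_zero order_trans by blast

lemma modulus_le: "modulus z \<le> \<bar>re_part z\<bar> + \<bar>im_part z\<bar>"
proof (rule modulus_least)
  fix \<theta> :: real
  have "c *\<^sub>R x \<le> \<bar>x\<bar>" if "\<bar>c\<bar> \<le> 1" for c and x :: 'a
    using scaleR_le_abs[of c x] scaleR_right_mono[OF that, of "\<bar>x\<bar>"] by simp
  then show "cos \<theta> *\<^sub>R re_part z + sin \<theta> *\<^sub>R im_part z \<le> \<bar>re_part z\<bar> + \<bar>im_part z\<bar>"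
    by (intro add_mono) auto
qed

instantiation complexification :: (real_vector) real_vector
begin

definition "0 = Complexify 0 0"
definition "z + w = Complexify (re_part z + re_part w) (im_part z + im_part w)"
definition "z - w = Complexify (re_part z - re_part w) (im_part z - im_part w)"
definition "- z = Complexify (- re_part z) (- im_part z)"
definition "r *\<^sub>R z = Complexify (r *\<^sub>R re_part z) (r *\<^sub>R im_part z)"

instance
  by standard (auto simp: complexification_eq_iff zero_complexification_def plus_complexification_def
      minus_complexification_def uminus_complexification_def scaleR_complexification_def algebra_simps)

end

lemma part_simps [simp]:
  "re_part 0 = 0" "im_part 0 = 0"
  "re_part (z + w) = re_part z + re_part w" "im_part (z + w) = im_part z + im_part w"
  "re_part (z - w) = re_part z - re_part w" "im_part (z - w) = im_part z - im_part w"
  "re_part (- z) = - re_part z" "im_part (- z) = - im_part z"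
  "re_part (r *\<^sub>R z) = r *\<^sub>R re_part z" "im_part (r *\<^sub>R z) = r *\<^sub>R im_part z"
  by (simp_all add: zero_complexification_def plus_complexification_def
      minus_complexification_def uminus_complexification_def scaleR_complexification_def)

definition scaleC :: "complex \<Rightarrow> 'a::real_vector complexification \<Rightarrow> 'a complexification" where
  "scaleC c z = Complexify (Re c *\<^sub>R re_part z - Im c *\<^sub>R im_part z)
                           (Re c *\<^sub>R im_part z + Im c *\<^sub>R re_part z)"

lemma scaleC_vector_space: "vector_space scaleC"
  by standard (auto simp: complexification_eq_iff scaleC_def algebra_simps)

lemma scaleC_of_real: "scaleC (of_real r) z = r *\<^sub>R z"
  by (simp add: complexification_eq_iff scaleC_def)

lemma modulus_add: "modulus (z + w) \<le> modulus z + modulus w"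
proof (rule modulus_least)
  fix \<theta>
  show "cos \<theta> *\<^sub>R re_part (z + w) + sin \<theta> *\<^sub>R im_part (z + w) \<le> modulus z + modulus w"
    using add_mono[OF rotation_le_modulus[of \<theta> z] rotation_le_modulus[of \<theta> w]]
    by (simp add: algebra_simps)
qed

lemma modulus_scaleC_le: "modulus (scaleC c z) \<le> cmod c *\<^sub>R modulus z"
proof (rule modulus_least)
  fix \<theta>
  define r a where "r = cmod c" and "a = Arg c"
  have c: "Re c = r * cos a" "Im c = r * sin a"
    using rcis_cmod_Arg[of c] unfolding r_def a_def by (metis Re_rcis, metis Im_rcis)
  have "cos \<theta> *\<^sub>R re_part (scaleC c z) + sin \<theta> *\<^sub>R im_part (scaleC c z) =
      r *\<^sub>R (cos (\<theta> - a) *\<^sub>R re_part z + sin (\<theta> - a) *\<^sub>R im_part z)"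
    by (simp add: scaleC_def c cos_diff sin_diff algebra_simps)
  also have "\<dots> \<le> r *\<^sub>R modulus z"
    by (intro scaleR_left_mono rotation_le_modulus) (simp add: r_def)
  finally show "cos \<theta> *\<^sub>R re_part (scaleC c z) + sin \<theta> *\<^sub>R im_part (scaleC c z) \<le> cmod c *\<^sub>R modulus z"
    by (simp add: r_def)
qed

lemma modulus_scaleC: "modulus (scaleC c z) = cmod c *\<^sub>R modulus z"
proof (cases "c = 0")
  case True
  have "modulus (scaleC 0 z) = 0"
    using modulus_scaleC_le[of 0 z] modulus_nonneg[of "scaleC 0 z"] by simp
  then show ?thesis using True by simp
next
  case False
  interpret vector_space "scaleC :: complex \<Rightarrow> 'a complexification \<Rightarrow> _" by (rule scaleC_vector_space)
  have "modulus z \<le> cmod (inverse c) *\<^sub>R modulus (scaleC c z)"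
    using modulus_scaleC_le[of "inverse c" "scaleC c z"] False by simp
  then have "cmod c *\<^sub>R modulus z \<le> cmod c *\<^sub>R cmod (inverse c) *\<^sub>R modulus (scaleC c z)"
    by (rule scaleR_left_mono) simp
  also have "\<dots> = modulus (scaleC c z)" using False by (simp add: norm_inverse)
  finally show ?thesis using modulus_scaleC_le[of c z] by (simp add: antisym)
qed

instantiation complexification :: (banach_lattice) real_normed_vector
begin

definition "norm z = norm (modulus z)"
definition "sgn z = z /\<^sub>R norm (z::'a complexification)"
definition "dist z w = norm (z - w :: 'a complexification)"
definition [code del]:
  "(uniformity :: ('a complexification \<times> 'a complexification) filter) =
    (INF e\<in>{0 <..}. principal {(x, y). dist x y < e})"
definition [code del]:
  "open (U :: 'a complexification set) \<longleftrightarrow> (\<forall>x\<in>U. \<forall>\<^sub>F (x', y) in uniformity. x' = x \<longrightarrow> y \<in> U)"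

instance
proof
  fix z w :: "'a complexification" and r :: real
  show "norm z = 0 \<longleftrightarrow> z = 0"
  proof
    assume "norm z = 0"
    then show "z = 0"
      using modulus_ge_re[of z] modulus_ge_im[of z]
      by (simp add: norm_complexification_def complexification_eq_iff)
  next
    assume "z = 0"
    then show "norm z = 0" using modulus_le[of z] modulus_nonneg[of z]
      by (simp add: norm_complexification_def)
  qed
  have "norm (modulus (z + w)) \<le> norm (modulus z + modulus w)"
    by (intro norm_mono_pos modulus_nonneg modulus_add)
  then show "norm (z + w) \<le> norm z + norm w"
    unfolding norm_complexification_def using norm_triangle_ineq order_trans by blast
  show "norm (r *\<^sub>R z) = \<bar>r\<bar> * norm z"
    by (simp add: norm_complexification_def modulus_scaleC flip: scaleC_of_real)
qed (simp_all add: sgn_complexification_def dist_complexification_def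
      uniformity_complexification_def open_complexification_def)

end

lemma norm_scaleC: "norm (scaleC c z) = cmod c * norm z"
  by (simp add: norm_complexification_def modulus_scaleC)

lemma norm_re_part_le: "norm (re_part z) \<le> norm z" and norm_im_part_le: "norm (im_part z) \<le> norm z"
  using norm_mono_abs[of "re_part z" "modulus z"] norm_mono_abs[of "im_part z" "modulus z"]
    modulus_ge_re[of z] modulus_ge_im[of z] modulus_nonneg[of z]
  by (simp_all add: norm_complexification_def)

lemma norm_complexification_le: "norm z \<le> norm (re_part z) + norm (im_part z)"
proof -
  have "norm z \<le> norm (\<bar>re_part z\<bar> + \<bar>im_part z\<bar>)"
    unfolding norm_complexification_def by (intro norm_mono_pos modulus_nonneg modulus_le)
  also have "\<dots> \<le> norm (re_part z) + norm (im_part z)"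
    by (rule order_trans[OF norm_triangle_ineq]) simp
  finally show ?thesis .
qed

instance complexification :: (banach_lattice) banach
proof
  fix X :: "nat \<Rightarrow> 'a complexification"
  assume "Cauchy X"
  have "bounded_linear (re_part :: 'a complexification \<Rightarrow> 'a)"
    "bounded_linear (im_part :: 'a complexification \<Rightarrow> 'a)"
    by (rule bounded_linear_intro[where K = 1]; simp add: norm_re_part_le norm_im_part_le)+
  then have "Cauchy (\<lambda>n. re_part (X n))" "Cauchy (\<lambda>n. im_part (X n))"
    using \<open>Cauchy X\<close> bounded_linear.Cauchy by blast+
  then obtain x y where "(\<lambda>n. re_part (X n)) \<longlonglongrightarrow> x" "(\<lambda>n. im_part (X n)) \<longlonglongrightarrow> y"
    unfolding Cauchy_convergent_iff convergent_def by blast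
  then have "(\<lambda>n. norm (re_part (X n) - x) + norm (im_part (X n) - y)) \<longlonglongrightarrow> 0"
    by (auto intro!: tendsto_add_zero tendsto_norm_zero LIM_zero)
  then have "(\<lambda>n. X n - Complexify x y) \<longlonglongrightarrow> 0"
    by (rule Lim_null_comparison[rotated])
      (use norm_complexification_le[of "X _ - Complexify x y"] in auto)
  then show "convergent X" unfolding convergent_def using LIM_zero_cancel by blast
qed

text \<open>The real part is embedded as \<open>{z. im_part z = 0}\<close>, and it contains both the positive cone
  and the values of the modulus. As for \<open>complex\<close> numbers, \<open>z \<le> w\<close> means that \<open>w - z\<close> is real
  and positive.\<close>

instantiation complexification :: (banach_lattice) "{order, abs}"
begin

definition "\<bar>z\<bar> = Complexify (modulus z) 0"
definition "z \<le> w \<longleftrightarrow> re_part z \<le> re_part w \<and> im_part z = im_part w"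
definition "z < w \<longleftrightarrow> re_part z < re_part w \<and> im_part z = im_part w"

instance
  by standard (auto simp: less_eq_complexification_def less_complexification_def
      complexification_eq_iff)

end

section \<open>Operators\<close>

definition principal_ideal :: "'a::{ord,abs,real_vector} \<Rightarrow> 'a set" where
  "principal_ideal u = {f. \<exists>c::real. c \<ge> 0 \<and> \<bar>f\<bar> \<le> c *\<^sub>R u}"

text \<open>In the following notions \<open>smul\<close> is the scalar multiplication of the space \<open>'v\<close> over its
  scalar field \<open>'k\<close>: \<open>scaleR\<close> for a real Banach lattice and \<open>scaleC\<close> for a complex one.\<close>

definition bounded_operators :: "('k \<Rightarrow> 'v \<Rightarrow> 'v) \<Rightarrow> ('v::real_normed_vector \<Rightarrow> 'v) set" where
  "bounded_operators smul = {T. bounded_linear T \<and> (\<forall>c v. T (smul c v) = smul c (T v))}"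

definition dual_space ::
  "('k::real_normed_field \<Rightarrow> 'v \<Rightarrow> 'v) \<Rightarrow> ('v::real_normed_vector \<Rightarrow> 'k) set" where
  "dual_space smul = {f. bounded_linear f \<and> (\<forall>c v. f (smul c v) = c * f v)}"

text \<open>Functionals on the dual space are total functions of which only the values on
  \<open>dual_space smul\<close> matter; the norm of the dual space is the operator norm \<open>onorm\<close>.\<close>

definition bidual_functional ::
  "('k::real_normed_field \<Rightarrow> 'v \<Rightarrow> 'v) \<Rightarrow> (('v::real_normed_vector \<Rightarrow> 'k) \<Rightarrow> 'k) \<Rightarrow> bool" where
  "bidual_functional smul \<phi> \<longleftrightarrow>
     (\<forall>f\<in>dual_space smul. \<forall>g\<in>dual_space smul. \<phi> (\<lambda>v. f v + g v) = \<phi> f + \<phi> g) \<and>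
     (\<forall>c. \<forall>f\<in>dual_space smul. \<phi> (\<lambda>v. c * f v) = c * \<phi> f) \<and>
     (\<exists>K. \<forall>f\<in>dual_space smul. norm (\<phi> f) \<le> K * onorm f)"

definition reflexive_space :: "('k::real_normed_field \<Rightarrow> 'v::real_normed_vector \<Rightarrow> 'v) \<Rightarrow> bool" where
  "reflexive_space smul \<longleftrightarrow>
     (\<forall>\<phi>. bidual_functional smul \<phi> \<longrightarrow> (\<exists>v. \<forall>f\<in>dual_space smul. \<phi> f = f v))"

definition compact_operator :: "('k \<Rightarrow> 'v \<Rightarrow> 'v) \<Rightarrow> ('v::real_normed_vector \<Rightarrow> 'v) \<Rightarrow> bool" where
  "compact_operator smul T \<longleftrightarrow>
     T \<in> bounded_operators smul \<and> compact (closure (T ` cball 0 1))"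

end

theory Submission
  imports Defs "HOL-Complex_Analysis.Great_Picard"
begin

text \<open>By the closed graph theorem an operator \<open>T\<close> with range in the principal ideal of \<open>u\<close> is bounded
  for the order unit norm of that ideal, i.e. \<open>\<bar>T x\<bar> \<le> K (norm x) u\<close>.  The ideal with this norm
  is a space of continuous functions on a compact space, and in such a space a weakly convergent
  sequence is bounded and converges pointwise; under an order continuous norm this implies norm
  convergence in the large lattice, by dominated convergence.  So \<open>T\<close> maps weakly convergent
  sequences to norm convergent ones.  In a reflexive space every bounded sequence has a weakly
  convergent subsequence, and \<open>T\<close> is compact.  If only the norm is order continuous, order
  intervals are still weakly compact; as \<open>T\<close> maps the unit ball into an order interval, applying
  \<open>T\<close> once more gives a compact operator.

  The proof below carries this out without representing the ideal by functions and without weak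
  topologies.  A weak limit is replaced by a point in the closed convex hulls of all tails of the
  sequence (\<open>tail_hull_point\<close>).  Such points exist for bounded sequences in a reflexive space by
  the Hahn-Banach theorem (\<open>reflexive_imp_tail_hull_point\<close>), and for order bounded sequences by
  minimising a suitable strictly convex function over convex combinations
  (\<open>order_bounded_imp_tail_hull_point\<close>).  A diagonal argument provides a subsequence all of whose
  subsequences share one such point (\<open>stable_subsequence\<close>).

  The place of pointwise convergence and dominated convergence is taken by
  \<open>finitely_meeting_subsequence\<close>: positive elements of an order interval that stay away from
  \<open>0\<close> in norm have a subsequence any finitely many members of which have a nonzero infimum, just as
  sets of measure at least \<open>d\<close> have a subsequence with the finite intersection property.  If
  \<open>T (x n)\<close> did not converge to \<open>T v\<close>, this would keep \<open>T c - T v\<close> away from \<open>0\<close> in the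
  order unit norm for all convex combinations \<open>c\<close> of a subsequence, although some of them approach
  \<open>v\<close> (\<open>stable_point_pprt_tendsto\<close>).  All this needs from the norm is that order bounded
  increasing sequences converge, which holds under order continuity and under reflexivity.

  A complex operator is split into two real operators on the real part, and reflexivity passes to
  the real part.\<close>

section \<open>Sublinear functionals and the Hahn-Banach theorem\<close>

definition sublinear :: "('a::real_vector \<Rightarrow> real) \<Rightarrow> bool" where
  "sublinear p \<longleftrightarrow> (\<forall>x y. p (x + y) \<le> p x + p y) \<and> (\<forall>c x. 0 \<le> c \<longrightarrow> p (c *\<^sub>R x) = c * p x)"

lemma sublinearD:
  assumes "sublinear p"
  shows "p (x + y) \<le> p x + p y" "0 \<le> c \<Longrightarrow> p (c *\<^sub>R x) = c * p x" "p 0 = 0" "- p (- x) \<le> p x"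
proof -
  show a: "p (x + y) \<le> p x + p y" and h: "0 \<le> c \<Longrightarrow> p (c *\<^sub>R x) = c * p x" for x y c
    using assms by (auto simp: sublinear_def)
  show z: "p 0 = 0" using h[of 0 0] by simp
  show "- p (- x) \<le> p x" using a[of x "- x"] z by simp
qed

lemma sublinearI:
  assumes add: "\<And>x y. p (x + y) \<le> p x + p y" and le: "\<And>c x. 0 < c \<Longrightarrow> p (c *\<^sub>R x) \<le> c * p x"
    and "p 0 = 0"
  shows "sublinear p"
  unfolding sublinear_def
proof (intro conjI allI impI add)
  fix c :: real and x assume "0 \<le> c"
  show "p (c *\<^sub>R x) = c * p x"
  proof (cases "c = 0")
    case False
    with \<open>0 \<le> c\<close> have c: "0 < c" by simp
    from le[of "inverse c" "c *\<^sub>R x"] c have "c * p x \<le> p (c *\<^sub>R x)" by (simp add: field_simps)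
    with le[OF c, of x] show ?thesis by simp
  qed (simp add: \<open>p 0 = 0\<close>)
qed

text \<open>Constraints \<open>f k \<ge> s\<close> for the pairs of a convex cone can be absorbed into a sublinear
  functional: any linear functional below the minorant satisfies all of them.  This one construction
  yields both the linearity of minimal sublinear functionals and the separation of convex sets.\<close>

lemma sublinear_cone_minorant:
  fixes p :: "'a::real_vector \<Rightarrow> real" and K :: "('a \<times> real) set"
  assumes p: "sublinear p"
    and K0: "0 \<in> K" and Kadd: "\<And>k l. k \<in> K \<Longrightarrow> l \<in> K \<Longrightarrow> k + l \<in> K"
    and Kscale: "\<And>c k. 0 < c \<Longrightarrow> k \<in> K \<Longrightarrow> c *\<^sub>R k \<in> K"
    and Kle: "\<And>k s. (k, s) \<in> K \<Longrightarrow> s \<le> p k"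
  obtains q where "sublinear q" "\<And>x. q x \<le> p x" "\<And>k s. (k, s) \<in> K \<Longrightarrow> q (- k) \<le> - s"
proof -
  define q where "q x = (INF k\<in>K. p (x + fst k) - snd k)" for x
  have low: "- p (- x) \<le> p (x + fst k) - snd k" if "k \<in> K" for x k
  proof -
    have "snd k \<le> p ((x + fst k) + (- x))" using Kle[of "fst k" "snd k"] that by simp
    also have "\<dots> \<le> p (x + fst k) + p (- x)" by (rule sublinearD(1)[OF p])
    finally show ?thesis by simp
  qed
  have bdd: "bdd_below ((\<lambda>k. p (x + fst k) - snd k) ` K)" for x
    by (rule bdd_belowI[of _ "- p (- x)"]) (use low in auto)
  have q_le: "q x \<le> p (x + fst k) - snd k" if "k \<in> K" for x k
    unfolding q_def by (rule cINF_lower[OF bdd]) (use that in simp)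
  have q_ge: "b \<le> q x" if "\<And>k. k \<in> K \<Longrightarrow> b \<le> p (x + fst k) - snd k" for b x
    unfolding q_def by (rule cINF_greatest) (use that K0 in auto)
  have add: "q (x + z) \<le> q x + q z" for x z
  proof -
    have "q (x + z) - (p (z + fst l) - snd l) \<le> q x" if l: "l \<in> K" for l
    proof (rule q_ge)
      fix k assume k: "k \<in> K"
      have "q (x + z) \<le> p ((x + z) + fst (k + l)) - snd (k + l)"
        by (rule q_le[OF Kadd[OF k l]])
      also have "(x + z) + fst (k + l) = (x + fst k) + (z + fst l)"
        by (simp add: algebra_simps)
      also have "p \<dots> \<le> p (x + fst k) + p (z + fst l)" by (rule sublinearD(1)[OF p])
      finally show "q (x + z) - (p (z + fst l) - snd l) \<le> p (x + fst k) - snd k"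
        by (simp add: algebra_simps)
    qed
    then have "q (x + z) - q x \<le> q z" by (intro q_ge) (simp add: algebra_simps)
    then show ?thesis by simp
  qed
  have hom_le: "q (c *\<^sub>R x) \<le> c * q x" if c: "0 < c" for c x
  proof -
    have "q (c *\<^sub>R x) / c \<le> q x"
    proof (rule q_ge)
      fix k assume k: "k \<in> K"
      have "q (c *\<^sub>R x) \<le> p (c *\<^sub>R x + fst (c *\<^sub>R k)) - snd (c *\<^sub>R k)"
        by (rule q_le[OF Kscale[OF c k]])
      also have "c *\<^sub>R x + fst (c *\<^sub>R k) = c *\<^sub>R (x + fst k)" by (simp add: algebra_simps)
      also have "p \<dots> = c * p (x + fst k)" by (rule sublinearD(2)[OF p]) (use c in simp)
      finally show "q (c *\<^sub>R x) / c \<le> p (x + fst k) - snd k"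
        using c by (simp add: field_simps)
    qed
    then show ?thesis using c by (simp add: field_simps)
  qed
  have "sublinear q"
  proof (rule sublinearI)
    have "0 \<le> q 0" by (rule q_ge) (use Kle in auto)
    moreover have "q 0 \<le> 0" using q_le[OF K0, of 0] sublinearD(3)[OF p] by simp
    ultimately show "q 0 = 0" by simp
  qed (fact add hom_le)+
  moreover have "q x \<le> p x" for x using q_le[OF K0, of x] by simp
  moreover have "q (- k) \<le> - s" if "(k, s) \<in> K" for k s
    using q_le[OF that, of "- k"] sublinearD(3)[OF p] by simp
  ultimately show ?thesis using that by blast
qed

lemma sublinear_directional_minorant:
  fixes p :: "'a::real_vector \<Rightarrow> real"
  assumes p: "sublinear p"
  obtains q where "sublinear q" "\<And>x. q x \<le> p x" "q (- y) \<le> - p y"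
proof -
  define K where "K = (\<lambda>t. (t *\<^sub>R y, t * p y)) ` {0..}"
  have K: "(t *\<^sub>R y, t * p y) \<in> K" if "0 \<le> t" for t using that by (auto simp: K_def)
  show ?thesis
  proof (rule sublinear_cone_minorant[OF p])
    show "0 \<in> K" using K[of 0] by (simp add: zero_prod_def)
    show "k + l \<in> K" if kl: "k \<in> K" "l \<in> K" for k l
    proof -
      obtain s t where "0 \<le> s" "0 \<le> t" "k = (s *\<^sub>R y, s * p y)" "l = (t *\<^sub>R y, t * p y)"
        using kl by (auto simp: K_def)
      then show ?thesis using K[of "s + t"] by (simp add: algebra_simps)
    qed
    show "c *\<^sub>R k \<in> K" if c: "0 < c" and k: "k \<in> K" for c k
    proof -
      obtain s where "0 \<le> s" "k = (s *\<^sub>R y, s * p y)" using k by (auto simp: K_def)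
      then show ?thesis using K[of "c * s"] c by (simp add: mult.assoc)
    qed
    show "s \<le> p k" if "(k, s) \<in> K" for k s
      using that sublinearD(2)[OF p] by (auto simp: K_def)
    fix q assume "sublinear q" "\<And>x. q x \<le> p x" "\<And>k s. (k, s) \<in> K \<Longrightarrow> q (- k) \<le> - s"
    then show ?thesis using that K[of 1] by simp
  qed
qed

text \<open>A minimal sublinear functional coincides with its minorant in the direction \<open>y\<close>, whence
  \<open>q (- y) \<le> - q y\<close>; together with sublinearity this makes \<open>q\<close> odd, hence additive and
  homogeneous.\<close>

lemma minimal_sublinear_is_linear:
  fixes q :: "'a::real_vector \<Rightarrow> real"
  assumes q: "sublinear q"
    and min: "\<And>r. sublinear r \<Longrightarrow> (\<And>x. r x \<le> q x) \<Longrightarrow> r = q"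
  shows "linear q"
proof -
  have neg: "q (- y) = - q y" for y
  proof -
    obtain r where r: "sublinear r" "\<And>x. r x \<le> q x" "r (- y) \<le> - q y"
      by (rule sublinear_directional_minorant[OF q, of y]) blast
    then have "r = q" by (intro min) auto
    then show ?thesis using r(3) sublinearD(4)[OF q, of y] by simp
  qed
  show ?thesis
  proof (rule linearI)
    fix x y
    have "q x = q ((x + y) + (- y))" by simp
    also have "\<dots> \<le> q (x + y) + q (- y)" by (rule sublinearD(1)[OF q])
    finally show "q (x + y) = q x + q y" using sublinearD(1)[OF q, of x y] neg by simp
    fix c :: real
    show "q (c *\<^sub>R x) = c *\<^sub>R q x"
    proof (cases "0 \<le> c")
      case True then show ?thesis using sublinearD(2)[OF q] by simp
    next
      case False
      then have "q (- ((- c) *\<^sub>R x)) = - ((- c) * q x)"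
        by (subst neg, subst sublinearD(2)[OF q]) auto
      then show ?thesis by simp
    qed
  qed
qed

text \<open>Zorn's lemma yields a minimal sublinear functional below \<open>p\<close>.  Starting from the minorant
  of \<open>p\<close> in the direction \<open>y\<close> instead of \<open>p\<close> itself fixes the value at \<open>y\<close>.\<close>

lemma hahn_banach:
  fixes p :: "'a::real_vector \<Rightarrow> real"
  assumes p: "sublinear p"
  obtains f where "linear f" "\<And>x. f x \<le> p x" "f y = p y"
proof -
  obtain p' where p': "sublinear p'" "\<And>x. p' x \<le> p x" "p' (- y) \<le> - p y"
    by (rule sublinear_directional_minorant[OF p, of y]) blast
  define A where "A = {q. sublinear q \<and> (\<forall>x. q x \<le> p' x)}"
  define R where "R = (\<lambda>q r :: 'a \<Rightarrow> real. \<forall>x. r x \<le> q x)"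
  have "\<exists>m\<in>A. \<forall>a\<in>A. R m a \<longrightarrow> a = m"
  proof (rule predicate_Zorn)
    show "partial_order_on A (relation_of R A)"
      unfolding R_def partial_order_on_def preorder_on_def refl_on_def trans_def antisym_def relation_of_def
      by (auto intro: order_trans intro!: ext antisym)
    fix C assume "C \<in> Chains (relation_of R A)"
    then have CA: "C \<subseteq> A" and tot: "\<And>q r. q \<in> C \<Longrightarrow> r \<in> C \<Longrightarrow> (\<forall>x. q x \<le> r x) \<or> (\<forall>x. r x \<le> q x)"
      unfolding Chains_def relation_of_def R_def by blast+
    show "\<exists>u\<in>A. \<forall>a\<in>C. R a u"
    proof (cases "C = {}")
      case True
      then show ?thesis using p' by (auto simp: A_def)
    next
      case False
      define u where "u x = (INF q\<in>C. q x)" for x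
      have C: "sublinear q" "q x \<le> p' x" if "q \<in> C" for q x
        using CA that by (auto simp: A_def)
      have bdd: "bdd_below ((\<lambda>q. q x) ` C)" for x
      proof (rule bdd_belowI)
        fix s assume "s \<in> (\<lambda>q. q x) ` C"
        then obtain q where "q \<in> C" "s = q x" by blast
        then show "- p' (- x) \<le> s" using sublinearD(4)[OF C(1), of q x] C(2)[of q "- x"] by simp
      qed
      have u_le: "u x \<le> q x" if "q \<in> C" for q x
        unfolding u_def by (rule cINF_lower[OF bdd that])
      have u_ge: "b \<le> u x" if "\<And>q. q \<in> C \<Longrightarrow> b \<le> q x" for b x
        unfolding u_def by (rule cINF_greatest[OF False that])
      have add: "u (x + z) \<le> u x + u z" for x z
      proof -
        have "u (x + z) - r z \<le> u x" if r: "r \<in> C" for r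
        proof (rule u_ge)
          fix q assume q: "q \<in> C"
          have "u (x + z) \<le> q x + r z"
            using tot[OF q r] u_le[OF q, of "x + z"] u_le[OF r, of "x + z"]
              sublinearD(1)[OF C(1)[OF q], of x z] sublinearD(1)[OF C(1)[OF r], of x z]
            by (meson add_mono order_refl order_trans)
          then show "u (x + z) - r z \<le> q x" by simp
        qed
        then have "u (x + z) - u x \<le> u z" by (intro u_ge) (simp add: algebra_simps)
        then show ?thesis by simp
      qed
      have hom_le: "u (c *\<^sub>R x) \<le> c * u x" if c: "0 < c" for c x
      proof -
        have "u (c *\<^sub>R x) / c \<le> u x"
          by (rule u_ge) (use c u_le[of _ "c *\<^sub>R x"] sublinearD(2)[OF C(1), of _ c x] in \<open>auto simp: field_simps\<close>)
        then show ?thesis using c by (simp add: field_simps)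
      qed
      have "u 0 = 0"
        using u_le[of _ 0] u_ge[of 0 0] sublinearD(3)[OF C(1)] False by (metis antisym equals0I order_refl)
      then have "sublinear u" using add hom_le by (intro sublinearI)
      from False obtain q0 where "q0 \<in> C" by blast
      then have "u x \<le> p' x" for x using u_le C(2) order_trans by blast
      with \<open>sublinear u\<close> have "u \<in> A" unfolding A_def by blast
      then show ?thesis using u_le unfolding R_def by blast
    qed
  qed
  then obtain m where m: "m \<in> A" "\<And>a. a \<in> A \<Longrightarrow> R m a \<Longrightarrow> a = m" by blast
  have "linear m"
  proof (rule minimal_sublinear_is_linear)
    show "sublinear m" using m(1) by (simp add: A_def)
    fix r assume "sublinear r" "\<And>x. r x \<le> m x"
    then show "r = m" using m unfolding A_def R_def by (blast intro: order_trans)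
  qed
  moreover have le: "m x \<le> p x" for x using m(1) p'(2)[of x] unfolding A_def by (auto intro: order_trans)
  moreover have "m y = p y"
  proof -
    have "m (- y) \<le> p' (- y)" using m(1) unfolding A_def by blast
    then have "- m y \<le> - p y" using p'(3) linear_neg[OF \<open>linear m\<close>, of y] by linarith
    with le[of y] show ?thesis by simp
  qed
  ultimately show ?thesis using that by blast
qed

section \<open>Reflexivity and the closed convex hulls of tails\<close>

lemma linear_le_norm_bounded_linear:
  fixes f :: "'a::real_normed_vector \<Rightarrow> real"
  assumes "linear f" "\<And>x. f x \<le> norm x"
  shows "bounded_linear f"
proof -
  interpret linear f by fact
  have "\<bar>f x\<bar> \<le> norm x" for x using assms(2)[of x] assms(2)[of "- x"] by (simp add: neg)
  then show ?thesis
    by (intro bounded_linear_intro[of _ 1]) (auto simp: add scale)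
qed

lemma norming_functional:
  fixes x :: "'a::real_normed_vector"
  obtains f :: "'a \<Rightarrow> real" where "bounded_linear f" "\<And>y. f y \<le> norm y" "f x = norm x"
proof -
  have "sublinear (norm :: 'a \<Rightarrow> real)"
    by (rule sublinearI) (auto simp: norm_triangle_ineq)
  then obtain f where f: "linear f" "\<And>y. f y \<le> norm y" "f x = norm x"
    by (rule hahn_banach[where y = x]) blast
  then show ?thesis using that[of f] linear_le_norm_bounded_linear[of f] by simp
qed

text \<open>With \<open>d\<close> the distance of \<open>v\<close> to \<open>C\<close>, every pair \<open>(t (c - v), t d)\<close> satisfies
  \<open>t d \<le> norm (t (c - v))\<close>, and by convexity of \<open>C\<close> these pairs form a convex cone, so that the
  norm has a sublinear minorant which enforces \<open>f (c - v) \<ge> d\<close>.\<close>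

lemma separating_functional:
  fixes C :: "'a::real_normed_vector set"
  assumes C: "convex C" "C \<noteq> {}" and v: "v \<notin> closure C"
  obtains f :: "'a \<Rightarrow> real" and d where "bounded_linear f" "0 < d" "\<And>c. c \<in> C \<Longrightarrow> f v + d \<le> f c"
proof -
  define d where "d = infdist v C"
  have d: "0 < d" using v C(2) in_closure_iff_infdist_zero[OF C(2), of v] infdist_nonneg[of v C]
    unfolding d_def by linarith
  have d_le: "d \<le> norm (c - v)" if "c \<in> C" for c
    using infdist_le[OF that, of v] by (simp add: d_def dist_norm norm_minus_commute)
  define K where "K = {(t *\<^sub>R (c - v), t * d) | t c. 0 \<le> t \<and> c \<in> C}"
  have K: "(t *\<^sub>R (c - v), t * d) \<in> K" if "0 \<le> t" "c \<in> C" for t c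
    using that by (auto simp: K_def)
  have sub: "sublinear (norm :: 'a \<Rightarrow> real)"
    by (rule sublinearI) (auto simp: norm_triangle_ineq)
  obtain q where q: "sublinear q" "\<And>x. q x \<le> norm x" "\<And>k s. (k, s) \<in> K \<Longrightarrow> q (- k) \<le> - s"
  proof (rule sublinear_cone_minorant[OF sub])
    show "0 \<in> K" using K[of 0] C(2) by (auto simp: zero_prod_def)
    show "k + l \<in> K" if kl: "k \<in> K" "l \<in> K" for k l
    proof -
      obtain s a where k: "0 \<le> s" "a \<in> C" "k = (s *\<^sub>R (a - v), s * d)"
        using kl(1) by (auto simp: K_def)
      obtain t b where l: "0 \<le> t" "b \<in> C" "l = (t *\<^sub>R (b - v), t * d)"
        using kl(2) by (auto simp: K_def)
      show ?thesis
      proof (cases "s + t = 0")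
        case True
        then have "s = 0" "t = 0" using k(1) l(1) by auto
        then show ?thesis using K[of 0 a] k l by simp
      next
        case False
        then have st: "0 < s + t" using k(1) l(1) by simp
        define c where "c = (s / (s + t)) *\<^sub>R a + (t / (s + t)) *\<^sub>R b"
        have "c \<in> C" unfolding c_def
          by (rule convexD[OF C(1)]) (use k l st in \<open>auto simp flip: add_divide_distrib\<close>)
        moreover have "(s + t) *\<^sub>R c = s *\<^sub>R a + t *\<^sub>R b"
          using st by (simp add: c_def scaleR_add_right)
        then have "k + l = ((s + t) *\<^sub>R (c - v), (s + t) * d)"
          using k l by (simp add: algebra_simps)
        ultimately show ?thesis using K[of "s + t" c] st by simp
      qed
    qed
    show "r *\<^sub>R k \<in> K" if r: "0 < r" and k: "k \<in> K" for r k
    proof -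
      obtain s a where k: "0 \<le> s" "a \<in> C" "k = (s *\<^sub>R (a - v), s * d)"
        using k by (auto simp: K_def)
      then show ?thesis using K[of "r * s" a] r by (simp add: mult.assoc)
    qed
    show "s \<le> norm k" if "(k, s) \<in> K" for k s
      using that d_le by (auto simp: K_def intro!: mult_left_mono)
  qed blast
  obtain f where f: "linear f" "\<And>x. f x \<le> q x"
    by (rule hahn_banach[OF q(1), where y = 0]) blast
  have "bounded_linear f"
    by (rule linear_le_norm_bounded_linear[OF f(1)]) (rule order_trans[OF f(2) q(2)])
  moreover have "f v + d \<le> f c" if "c \<in> C" for c
    using f(2)[of "- (c - v)"] q(3)[OF K[of 1 c, OF _ that, simplified]] linear_diff[OF f(1), of v c]
    by simp
  ultimately show ?thesis using that[of f d] d by blast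
qed

lemma dual_space_scaleR: "dual_space (scaleR :: real \<Rightarrow> 'a \<Rightarrow> 'a::real_normed_vector) = {f. bounded_linear f}"
  unfolding dual_space_def by (auto simp: linear_simps)

text \<open>These points take the place of weak cluster points, which are of this kind by the separation
  theorem.\<close>

definition tail_hull_point :: "(nat \<Rightarrow> 'a::real_normed_vector) \<Rightarrow> 'a \<Rightarrow> bool" where
  "tail_hull_point x v \<longleftrightarrow> (\<forall>k. v \<in> closure (convex hull (x ` {k..})))"

text \<open>A linear functional on the dual space below \<open>F \<mapsto> limsup F (x n)\<close> is bounded, so by
  reflexivity it is evaluation at some \<open>v\<close>.  If \<open>v\<close> were separated from the tail hull by a
  functional \<open>f\<close>, the limit superior along \<open>- f\<close> would be smaller than \<open>- f v\<close>.\<close>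

lemma reflexive_imp_tail_hull_point:
  fixes x :: "nat \<Rightarrow> 'a::real_normed_vector"
  assumes refl: "reflexive_space (scaleR :: real \<Rightarrow> 'a \<Rightarrow> 'a)"
    and bdd: "\<And>n. norm (x n) \<le> B"
  shows "\<exists>v. tail_hull_point x v"
proof -
  define p where "p F = (INF k. SUP n\<in>{k..}. blinfun_apply F (x n))" for F :: "'a \<Rightarrow>\<^sub>L real"
  have abs_le: "\<bar>blinfun_apply F (x n)\<bar> \<le> B * norm F" for F :: "'a \<Rightarrow>\<^sub>L real" and n
    using norm_blinfun[of F "x n"] mult_left_mono[OF bdd[of n], of "norm F"] by (simp add: mult.commute)
  define S where "S F k = (SUP n\<in>{k..}. blinfun_apply F (x n))" for F :: "'a \<Rightarrow>\<^sub>L real" and k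
  have bdA: "bdd_above ((\<lambda>n. blinfun_apply F (x n)) ` {k..})" for F :: "'a \<Rightarrow>\<^sub>L real" and k
    by (rule bdd_aboveI2[where M = "B * norm F"]) (use abs_le in \<open>auto dest: abs_le_D1\<close>)
  have S_ge: "blinfun_apply F (x n) \<le> S F k" if "k \<le> n" for F n k
    unfolding S_def by (rule cSUP_upper[OF _ bdA]) (use that in simp)
  have S_le: "S F k \<le> b" if "\<And>n. k \<le> n \<Longrightarrow> blinfun_apply F (x n) \<le> b" for F k b
    unfolding S_def by (rule cSUP_least) (use that in auto)
  have S_low: "- (B * norm F) \<le> S F k" for F k
    using S_ge[of k k F] abs_le[of F k] by linarith
  have bdB: "bdd_below (range (S F))" for F
    by (rule bdd_belowI[of _ "- (B * norm F)"]) (use S_low in auto)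
  have p: "p F = (INF k. S F k)" for F by (simp add: p_def S_def)
  have p_le: "p F \<le> S F k" for F k unfolding p by (rule cINF_lower[OF bdB]) simp
  have p_ge: "b \<le> p F" if "\<And>k. b \<le> S F k" for b F unfolding p by (rule cINF_greatest) (use that in auto)
  have "sublinear p"
  proof (rule sublinearI)
    fix F G
    have "p (F + G) - S G l \<le> p F" for l
    proof (rule p_ge)
      fix k
      have "p (F + G) \<le> S (F + G) (max k l)" by (rule p_le)
      also have "\<dots> \<le> S F k + S G l"
        by (rule S_le) (auto simp: blinfun.add_left intro!: add_mono S_ge)
      finally show "p (F + G) - S G l \<le> S F k" by simp
    qed
    then have "p (F + G) - p F \<le> p G" by (intro p_ge) (simp add: algebra_simps)
    then show "p (F + G) \<le> p F + p G" by simp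
  next
    fix c :: real and F assume c: "0 < c"
    have "p (c *\<^sub>R F) / c \<le> p F"
    proof (rule p_ge)
      fix k
      have "p (c *\<^sub>R F) \<le> S (c *\<^sub>R F) k" by (rule p_le)
      also have "\<dots> \<le> c * S F k"
        by (rule S_le) (use c in \<open>auto simp: blinfun.scaleR_left intro!: mult_left_mono S_ge\<close>)
      finally show "p (c *\<^sub>R F) / c \<le> S F k" using c by (simp add: field_simps)
    qed
    then show "p (c *\<^sub>R F) \<le> c * p F" using c by (simp add: field_simps)
  next
    show "p 0 = 0" unfolding p_def by simp
  qed
  then obtain L where L: "linear L" "\<And>F. L F \<le> p F"
    by (rule hahn_banach[where y = 0]) blast
  interpret L: linear L by (rule L(1))
  have LB: "L F \<le> B * norm F" for F
  proof -
    have "S F 0 \<le> B * norm F" by (rule S_le) (use abs_le in \<open>auto dest: abs_le_D1\<close>)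
    then show ?thesis using L(2)[of F] p_le[of F 0] by linarith
  qed
  define \<phi> where "\<phi> f = L (Blinfun f)" for f :: "'a \<Rightarrow> real"
  have "bidual_functional scaleR \<phi>"
    unfolding bidual_functional_def dual_space_scaleR
  proof (intro conjI ballI allI exI[of _ B]; unfold mem_Collect_eq)
    fix f g :: "'a \<Rightarrow> real" and c :: real
    assume f: "bounded_linear f"
    have "Blinfun (\<lambda>v. c * f v) = c *\<^sub>R Blinfun f"
      using f by (intro blinfun_eqI)
        (simp add: bounded_linear_Blinfun_apply bounded_linear_const_mult blinfun.scaleR_left)
    then show "\<phi> (\<lambda>v. c * f v) = c * \<phi> f" by (simp add: \<phi>_def L.scale)
    have "norm (Blinfun f) = onorm f" using f by (simp add: norm_blinfun.rep_eq bounded_linear_Blinfun_apply)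
    then show "norm (\<phi> f) \<le> B * onorm f"
      using LB[of "Blinfun f"] LB[of "- Blinfun f"] by (simp add: \<phi>_def L.neg)
    assume g: "bounded_linear g"
    have "Blinfun (\<lambda>v. f v + g v) = Blinfun f + Blinfun g"
      using f g by (intro blinfun_eqI)
        (simp add: bounded_linear_Blinfun_apply bounded_linear_add blinfun.add_left)
    then show "\<phi> (\<lambda>v. f v + g v) = \<phi> f + \<phi> g" by (simp add: \<phi>_def L.add)
  qed
  with refl have "\<exists>v. \<forall>f\<in>dual_space scaleR. \<phi> f = f v"
    unfolding reflexive_space_def by (elim allE[of _ \<phi>]) (rule mp)
  then obtain v where v: "\<And>f::'a \<Rightarrow> real. bounded_linear f \<Longrightarrow> \<phi> f = f v"
    unfolding dual_space_scaleR by auto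
  have "v \<in> closure (convex hull (x ` {k..}))" for k
  proof (rule ccontr)
    assume "v \<notin> closure (convex hull (x ` {k..}))"
    then obtain f :: "'a \<Rightarrow> real" and d where f: "bounded_linear f" "0 < d" "\<And>c. c \<in> convex hull (x ` {k..}) \<Longrightarrow> f v + d \<le> f c"
      by (rule separating_functional[OF convex_convex_hull, rotated]) auto
    have "S (- Blinfun f) k \<le> - f v - d"
    proof (rule S_le)
      fix n assume "k \<le> n"
      then have "x n \<in> convex hull (x ` {k..})" by (intro hull_inc) simp
      from f(3)[OF this] show "blinfun_apply (- Blinfun f) (x n) \<le> - f v - d"
        by (simp add: blinfun.minus_left bounded_linear_Blinfun_apply[OF f(1)])
    qed
    with L(2)[of "- Blinfun f"] p_le[of "- Blinfun f" k] have "L (- Blinfun f) \<le> - f v - d"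
      by linarith
    then show False using v[OF f(1)] f(2) by (simp add: \<phi>_def L.neg)
  qed
  then show ?thesis unfolding tail_hull_point_def by blast
qed

section \<open>Stable subsequences\<close>

text \<open>A bounded functional that converges along a sequence takes its limit at every point of the
  tail hulls.\<close>

lemma tail_hull_point_limit:
  fixes x :: "nat \<Rightarrow> 'a::real_normed_vector" and f :: "'a \<Rightarrow> real"
  assumes v: "tail_hull_point x v" and f: "bounded_linear f" and lim: "(\<lambda>n. f (x n)) \<longlonglongrightarrow> l"
  shows "f v = l"
proof -
  interpret bounded_linear f by fact
  have "\<bar>f v - l\<bar> \<le> e" if "0 < e" for e
  proof -
    obtain k where k: "\<And>n. k \<le> n \<Longrightarrow> \<bar>f (x n) - l\<bar> < e"
      using LIMSEQ_D[OF lim \<open>0 < e\<close>] unfolding real_norm_def by blast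
    have "convex (f -` cball l e)"
      by (rule convex_linear_vimage[OF linear_axioms]) simp
    moreover have "x ` {k..} \<subseteq> f -` cball l e"
      using k by (auto simp: dist_real_def abs_minus_commute less_imp_le)
    moreover have "closed (f -` cball l e)"
      by (intro continuous_closed_vimage linear_continuous_at f) simp
    ultimately have "closure (convex hull (x ` {k..})) \<subseteq> f -` cball l e"
      by (intro closure_minimal hull_minimal)
    then show ?thesis using v unfolding tail_hull_point_def by (auto simp: dist_real_def abs_minus_commute)
  qed
  then have "\<bar>f v - l\<bar> \<le> 0" by (rule field_le_epsilon[of _ 0, simplified])
  then show ?thesis by simp
qed

inductive_set op_closure :: "('a \<Rightarrow> 'a \<Rightarrow> 'a) \<Rightarrow> 'a set \<Rightarrow> 'a set" for f A where
  base: "a \<in> A \<Longrightarrow> a \<in> op_closure f A"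
| op: "a \<in> op_closure f A \<Longrightarrow> b \<in> op_closure f A \<Longrightarrow> f a b \<in> op_closure f A"

lemma op_closure_mono: "A \<subseteq> B \<Longrightarrow> op_closure f A \<subseteq> op_closure f B"
proof
  fix x assume AB: "A \<subseteq> B" and "x \<in> op_closure f A"
  from this(2) show "x \<in> op_closure f B"
    by induction (use AB in \<open>auto intro: op_closure.intros\<close>)
qed

lemma countable_op_closure:
  assumes "countable A"
  shows "countable (op_closure f A)"
proof -
  define S where "S = rec_nat A (\<lambda>_ B. B \<union> (\<lambda>(a, b). f a b) ` (B \<times> B))"
  have S: "S 0 = A" "S (Suc n) = S n \<union> (\<lambda>(a, b). f a b) ` (S n \<times> S n)" for n
    by (simp_all add: S_def)
  have "countable (S n)" for n
    by (induction n) (auto simp: S assms)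
  moreover have mono: "S m \<subseteq> S n" if "m \<le> n" for m n
    using that by (induction rule: dec_induct) (auto simp: S)
  have "op_closure f A \<subseteq> (\<Union>n. S n)"
  proof
    fix x assume "x \<in> op_closure f A"
    then show "x \<in> (\<Union>n. S n)"
    proof induction
      case (base a)
      then show ?case using S(1) by blast
    next
      case (op a b)
      then obtain m n where "a \<in> S m" "b \<in> S n" by blast
      then have "a \<in> S (max m n)" "b \<in> S (max m n)"
        using mono[of m "max m n"] mono[of n "max m n"] by auto
      then have "f a b \<in> S (Suc (max m n))" by (force simp: S)
      then show ?case by blast
    qed
  qed
  ultimately show ?thesis by (meson countable_UN countable_subset uncountable_def UNIV_I countableI_type)
qed

text \<open>The finite sums of rational multiples of the terms form such a set.\<close>

lemma countable_dense_in_span: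
  fixes x :: "nat \<Rightarrow> 'a::real_normed_vector"
  obtains D where "countable D" "D \<noteq> {}" "closure (span (range x)) \<subseteq> closure D"
proof -
  define A where "A = (\<lambda>(q, n). of_rat q *\<^sub>R x n) ` UNIV"
  define D where "D = op_closure (+) A"
  have "countable D" unfolding D_def A_def by (intro countable_op_closure) simp
  have AD: "A \<subseteq> D" unfolding D_def by (auto intro: op_closure.base)
  have add: "y + z \<in> closure D" if yz: "y \<in> closure D" "z \<in> closure D" for y z
  proof -
    obtain a b where ab: "\<And>n. a n \<in> D" "a \<longlonglongrightarrow> y" "\<And>n. b n \<in> D" "b \<longlonglongrightarrow> z"
      using yz unfolding closure_sequential by blast
    then have "\<forall>n. a n + b n \<in> D" "(\<lambda>n. a n + b n) \<longlonglongrightarrow> y + z"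
      unfolding D_def by (auto intro: op_closure.op tendsto_add)
    then show ?thesis unfolding closure_sequential by (intro exI conjI)
  qed
  have gen: "c *\<^sub>R x n \<in> closure D" for c n
  proof -
    have "c \<in> closure \<rat>"
      unfolding closure_approachable
    proof (intro allI impI)
      fix e :: real assume "0 < e"
      then obtain q where "q \<in> \<rat>" "c < q" "q < c + e"
        using Rats_dense_in_real[of c "c + e"] by auto
      then show "\<exists>q\<in>\<rat>. dist q c < e" by (intro bexI[of _ q]) (auto simp: dist_real_def)
    qed
    then obtain q where q: "\<And>k. q k \<in> \<rat>" "q \<longlonglongrightarrow> c"
      unfolding closure_sequential by blast
    have "\<forall>k. q k *\<^sub>R x n \<in> D"
    proof
      fix k
      obtain r where "q k = of_rat r" using q(1)[of k] Rats_cases by blast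
      then show "q k *\<^sub>R x n \<in> D" using AD unfolding A_def by auto
    qed
    moreover have "(\<lambda>k. q k *\<^sub>R x n) \<longlonglongrightarrow> c *\<^sub>R x n" by (intro tendsto_scaleR q tendsto_const)
    ultimately show ?thesis unfolding closure_sequential by (intro exI conjI)
  qed
  have "span (range x) \<subseteq> closure D"
  proof
    fix y assume "y \<in> span (range x)"
    then show "y \<in> closure D"
    proof (induction rule: span_induct_alt)
      case base
      show ?case using gen[of 0 0] by simp
    next
      case (step c y z)
      then show ?case using gen add by auto
    qed
  qed
  moreover have "D \<noteq> {}" using AD unfolding A_def by auto
  ultimately show ?thesis using that \<open>countable D\<close> by (metis closure_minimal closed_closure)
qed

text \<open>Countably many norming functionals detect every nonzero vector of a separable subspace.  Along
  a diagonal subsequence all of them converge, so that all tail hull points of further subsequences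
  agree: the subsequence behaves like a weakly convergent one.  This replaces the theorem of
  Eberlein and Smulian.\<close>

lemma stable_subsequence:
  fixes x :: "nat \<Rightarrow> 'a::real_normed_vector"
  assumes bdd: "\<And>n. norm (x n) \<le> B"
    and ex: "\<And>s :: nat \<Rightarrow> nat. strict_mono s \<Longrightarrow> \<exists>v. tail_hull_point (x \<circ> s) v"
  obtains r v where "strict_mono (r :: nat \<Rightarrow> nat)"
    "\<And>s :: nat \<Rightarrow> nat. strict_mono s \<Longrightarrow> tail_hull_point (x \<circ> r \<circ> s) v"
proof -
  obtain D where D: "countable D" "D \<noteq> {}" "closure (span (range x)) \<subseteq> closure D"
    by (rule countable_dense_in_span)
  define d where "d = from_nat_into D"
  have D_d: "D = range d" unfolding d_def using D by (simp add: range_from_nat_into)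
  have "\<forall>i. \<exists>f. bounded_linear f \<and> (\<forall>y. f y \<le> norm y) \<and> f (d i) = norm (d i)"
    using norming_functional by metis
  then obtain f where f: "\<And>i. bounded_linear (f i)" "\<And>i y. f i y \<le> norm y" "\<And>i. f i (d i) = norm (d i)"
    by metis
  have fabs: "\<bar>f i y\<bar> \<le> norm y" for i y
    using f(2)[of i y] f(2)[of i "- y"] linear_neg[OF bounded_linear.linear[OF f(1)], of i y] by simp
  have nb: "norm (f i (x n)) \<le> B" for i n using fabs[of i "x n"] bdd[of n] by (simp add: order_trans)
  obtain r :: "nat \<Rightarrow> nat" where r: "strict_mono r"
      "\<And>i. i \<in> UNIV \<Longrightarrow> \<exists>l. (\<lambda>n. f i (x (r n))) \<longlonglongrightarrow> l"
    by (rule function_convergent_subsequence[of UNIV "\<lambda>n i. f i (x n)" B]) (simp, rule nb, blast)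
  then obtain l where l: "\<And>i. (\<lambda>n. f i (x (r n))) \<longlonglongrightarrow> l i" by (metis UNIV_I)
  have span: "v \<in> closure (span (range x))" if "tail_hull_point (x \<circ> s) v" for v and s :: "nat \<Rightarrow> nat"
  proof -
    have "convex hull ((x \<circ> s) ` {0..}) \<subseteq> span (range x)"
      by (intro hull_minimal subspace_imp_convex subspace_span) (auto intro: span_base)
    then show ?thesis using that closure_mono unfolding tail_hull_point_def by blast
  qed
  have lim: "f i v = l i" if v: "tail_hull_point (x \<circ> r \<circ> s) v" and s: "strict_mono s" for i v and s :: "nat \<Rightarrow> nat"
    by (rule tail_hull_point_limit[OF v f(1)]) (use LIMSEQ_subseq_LIMSEQ[OF l s, of i] in \<open>simp add: o_def\<close>)
  have unique: "v = w" if v: "tail_hull_point (x \<circ> r \<circ> s) v" "strict_mono s"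
      and w: "tail_hull_point (x \<circ> r \<circ> t) w" "strict_mono t" for v w and s t :: "nat \<Rightarrow> nat"
  proof -
    have "v \<in> closure (span (range x))" "w \<in> closure (span (range x))"
      using span[of "r \<circ> s" v] span[of "r \<circ> t" w] v w by (simp_all add: o_assoc)
    then obtain a b where ab: "\<And>n. a n \<in> span (range x)" "a \<longlonglongrightarrow> v"
        "\<And>n. b n \<in> span (range x)" "b \<longlonglongrightarrow> w"
      unfolding closure_sequential by blast
    then have "\<forall>n. a n - b n \<in> span (range x)" "(\<lambda>n. a n - b n) \<longlonglongrightarrow> v - w"
      by (auto intro: span_diff tendsto_diff)
    then have "v - w \<in> closure (span (range x))" unfolding closure_sequential by (intro exI conjI)
    then have "v - w \<in> closure D" using D(3) by blast
    have zero: "f i (v - w) = 0" for i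
      using lim[OF v, of i] lim[OF w, of i] linear_diff[OF bounded_linear.linear[OF f(1)], of i v w] by simp
    have "norm (v - w) \<le> e" if "0 < e" for e
    proof -
      obtain i where i: "dist (d i) (v - w) < e / 2"
        using \<open>v - w \<in> closure D\<close> \<open>0 < e\<close> unfolding D_d closure_approachable by (metis half_gt_zero imageE)
      have "norm (d i) = f i (d i - (v - w))"
        using f(3)[of i] zero[of i] linear_diff[OF bounded_linear.linear[OF f(1)], of i "d i" "v - w"] by simp
      also have "\<dots> \<le> dist (d i) (v - w)" using f(2) by (simp add: dist_norm)
      finally show ?thesis
        using i norm_triangle_ineq[of "v - w - d i" "d i"] by (simp add: dist_norm norm_minus_commute)
    qed
    then have "norm (v - w) \<le> 0" by (rule field_le_epsilon[of _ 0, simplified])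
    then show ?thesis by simp
  qed
  obtain v where v: "tail_hull_point (x \<circ> r \<circ> id) v" using ex[OF r(1)] by auto
  show ?thesis
  proof (rule that[OF r(1)])
    fix s :: "nat \<Rightarrow> nat" assume s: "strict_mono s"
    obtain w where w: "tail_hull_point (x \<circ> r \<circ> s) w"
      using ex[OF strict_mono_o[OF r(1) s]] by (auto simp: o_assoc)
    with unique[OF v _ w s] show "tail_hull_point (x \<circ> r \<circ> s) v" by (simp add: strict_mono_id)
  qed
qed

section \<open>Lattice inequalities\<close>

lemma pprt_add_pprt_minus: "pprt x = x + pprt (- x)" for x :: "'a::lattice_ab_group_add"
  by (simp add: pprt_neg eq_diff_eq flip: prts)

lemma pprt_disjoint: "inf (pprt x) (pprt (- x)) = 0" for x :: "'a::lattice_ab_group_add"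
proof -
  have "inf (pprt x) (pprt (- x)) = inf x 0 + pprt (- x)"
    by (subst pprt_add_pprt_minus[of x]) (simp add: add_inf_distrib_right)
  then show ?thesis by (simp add: pprt_neg nprt_def del: neg_inf_eq_sup)
qed

lemma inf_add_le:
  fixes w a b :: "'a::lattice_ab_group_add"
  assumes "0 \<le> w" "0 \<le> a" "0 \<le> b"
  shows "inf w (a + b) \<le> inf w a + inf w b"
proof -
  let ?m = "inf w (a + b)"
  have m: "?m \<le> w" "?m \<le> a + b" by simp_all
  have "?m - b \<le> w" using add_mono[OF m(1) assms(3)] by (simp add: diff_le_eq)
  moreover have "?m - b \<le> a" using m(2) by (simp add: diff_le_eq)
  ultimately have 1: "?m - b \<le> inf w a" by simp
  have 0: "0 \<le> inf w a" using assms by simp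
  have "?m - inf w a \<le> b" using 1 unfolding diff_le_eq by (simp only: add.commute)
  moreover have "?m - inf w a \<le> w" using add_mono[OF m(1) 0] unfolding diff_le_eq by simp
  ultimately have "?m - inf w a \<le> inf w b" by (intro inf_greatest)
  then show ?thesis unfolding diff_le_eq by (simp only: add.commute)
qed

lemma disjoint_add:
  fixes w a b :: "'a::lattice_ab_group_add"
  assumes "0 \<le> w" "0 \<le> a" "0 \<le> b" "inf w a = 0" "inf w b = 0"
  shows "inf w (a + b) = 0"
  using inf_add_le[OF assms(1-3)] assms by (simp add: antisym)

lemma pprt_diff_eq: "pprt (a - b) = a - inf a b" for a b :: "'a::lattice_ab_group_add"
  by (simp add: pprt_def add_sup_distrib_left sup_commute)

lemma pprt_add_le: "pprt (a + b) \<le> pprt a + pprt b" for a b :: "'a::lattice_ab_group_add"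
  unfolding pprt_def by (intro sup_least add_mono add_nonneg_nonneg) auto

lemma pprt_le_abs: "pprt x \<le> \<bar>x\<bar>" for x :: "'a::lattice_ab_group_add_abs"
  unfolding pprt_def by (intro sup_least abs_ge_self abs_ge_zero)

lemma closed_atLeast_lattice: "closed {y. a \<le> y}" for a :: "'a::banach_lattice"
  unfolding closed_sequential_limits using banach_lattice_limit_ge[of _ _ 0 a] by blast

lemma closed_atMost_lattice: "closed {y. y \<le> a}" for a :: "'a::banach_lattice"
  unfolding closed_sequential_limits using banach_lattice_limit_le[of _ _ 0 a] by blast

lemma convex_atLeast_lattice: "convex {y. a \<le> y}" for a :: "'a::banach_lattice"
proof (rule convexI)
  fix x y and s t :: real assume "x \<in> {y. a \<le> y}" "y \<in> {y. a \<le> y}" and st: "0 \<le> s" "0 \<le> t" "s + t = 1"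
  then have "s *\<^sub>R a + t *\<^sub>R a \<le> s *\<^sub>R x + t *\<^sub>R y"
    by (intro add_mono scaleR_left_mono) auto
  then show "s *\<^sub>R x + t *\<^sub>R y \<in> {y. a \<le> y}" using st by (simp flip: scaleR_left_distrib)
qed

lemma convex_atMost_lattice: "convex {y. y \<le> a}" for a :: "'a::banach_lattice"
proof (rule convexI)
  fix x y and s t :: real assume "x \<in> {y. y \<le> a}" "y \<in> {y. y \<le> a}" and st: "0 \<le> s" "0 \<le> t" "s + t = 1"
  then have "s *\<^sub>R x + t *\<^sub>R y \<le> s *\<^sub>R a + t *\<^sub>R a"
    by (intro add_mono scaleR_left_mono) auto
  then show "s *\<^sub>R x + t *\<^sub>R y \<in> {y. y \<le> a}" using st by (simp flip: scaleR_left_distrib)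
qed

section \<open>Norms in which order bounded increasing sequences converge\<close>

text \<open>This consequence is common to order continuity of the norm and to reflexivity, so that both
  parts of the theorem can share the estimates for operators.\<close>

definition monotone_convergence_norm :: "'a::banach_lattice itself \<Rightarrow> bool" where
  "monotone_convergence_norm _ \<longleftrightarrow>
     (\<forall>(x :: nat \<Rightarrow> 'a) b. incseq x \<longrightarrow> (\<forall>n. x n \<le> b) \<longrightarrow> convergent x)"

lemma monotone_convergence_incseq:
  fixes x :: "nat \<Rightarrow> 'a::banach_lattice"
  assumes "monotone_convergence_norm TYPE('a)" "incseq x" "\<And>n. x n \<le> b"
  obtains l where "x \<longlonglongrightarrow> l" "\<And>n. x n \<le> l" "l \<le> b"
proof -
  obtain l where l: "x \<longlonglongrightarrow> l"
    using assms unfolding monotone_convergence_norm_def convergent_def by blast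
  have "x n \<le> l" for n
    by (rule banach_lattice_limit_ge[OF l, of n]) (use assms(2) in \<open>simp add: incseq_def\<close>)
  moreover have "l \<le> b" by (rule banach_lattice_limit_le[OF l]) (rule assms(3))
  ultimately show ?thesis using that l by blast
qed

lemma monotone_convergence_decseq:
  fixes x :: "nat \<Rightarrow> 'a::banach_lattice"
  assumes "monotone_convergence_norm TYPE('a)" "decseq x" "\<And>n. b \<le> x n"
  obtains l where "x \<longlonglongrightarrow> l" "\<And>n. l \<le> x n" "b \<le> l"
proof -
  obtain l where l: "(\<lambda>n. - x n) \<longlonglongrightarrow> l" "\<And>n. - x n \<le> l" "l \<le> - b"
    by (rule monotone_convergence_incseq[OF assms(1), of "\<lambda>n. - x n" "- b"])
      (use assms in \<open>auto simp: incseq_def decseq_def\<close>)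
  show ?thesis
    using tendsto_minus[OF l(1)] l(2,3) by (intro that[of "- l"]) (auto simp: minus_le_iff le_minus_iff)
qed

text \<open>The differences \<open>c - x n\<close> between upper bounds \<open>c\<close> and terms of the sequence are
  directed downwards.  Their infimum is \<open>0\<close>: subtracting a lower bound \<open>y\<close> from an upper bound of
  the sequence gives an upper bound again, so all multiples of \<open>y\<close> stay below \<open>b - x 0\<close>.\<close>

lemma order_continuous_norm_imp_monotone_convergence:
  assumes ocn: "order_continuous_norm TYPE('a::banach_lattice)"
  shows "monotone_convergence_norm TYPE('a)"
  unfolding monotone_convergence_norm_def
proof (intro allI impI)
  fix x :: "nat \<Rightarrow> 'a" and b
  assume inc: "incseq x" and b: "\<forall>n. x n \<le> b"
  define D where "D = {c - x n | c n. \<forall>m. x m \<le> c}"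
  have D: "c - x n \<in> D" if "\<And>m. x m \<le> c" for c n using that by (auto simp: D_def)
  have "downward_directed D"
    unfolding downward_directed_def
  proof (intro conjI ballI)
    show "D \<noteq> {}" using D[of b 0] b by auto
    fix y z assume yz: "y \<in> D" "z \<in> D"
    obtain c n where y: "y = c - x n" "\<And>m. x m \<le> c" using yz(1) by (auto simp: D_def)
    obtain d k where z: "z = d - x k" "\<And>m. x m \<le> d" using yz(2) by (auto simp: D_def)
    have "x n \<le> x (max n k)" "x k \<le> x (max n k)" using inc by (simp_all add: incseq_def)
    then show "\<exists>w\<in>D. w \<le> y \<and> w \<le> z"
      using D[of "inf c d" "max n k"] y z
      by (intro bexI[of _ "inf c d - x (max n k)"]) (auto intro!: diff_mono)
  qed
  moreover have "is_infimum D 0"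
    unfolding is_infimum_def
  proof (intro conjI ballI allI impI)
    fix y assume "y \<in> D" then show "0 \<le> y" by (auto simp: D_def)
  next
    fix y assume y: "\<forall>z\<in>D. y \<le> z"
    have ub: "x m \<le> b - real k *\<^sub>R y" for k m
    proof (induction k arbitrary: m)
      case 0 then show ?case using b by simp
    next
      case (Suc k)
      have "y \<le> (b - real k *\<^sub>R y) - x m" using D[OF Suc] y by blast
      then show ?case by (simp add: algebra_simps le_diff_eq)
    qed
    have le: "y \<le> (1 / real (Suc k)) *\<^sub>R (b - x 0)" for k
    proof -
      have "real (Suc k) *\<^sub>R y \<le> b - x 0" using ub[of 0 "Suc k"] by (simp add: le_diff_eq algebra_simps)
      then have "(1 / real (Suc k)) *\<^sub>R (real (Suc k) *\<^sub>R y) \<le> (1 / real (Suc k)) *\<^sub>R (b - x 0)"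
        by (rule scaleR_left_mono) simp
      then show ?thesis by simp
    qed
    have "(\<lambda>k. (1 / real (Suc k)) *\<^sub>R (b - x 0)) \<longlonglongrightarrow> 0 *\<^sub>R (b - x 0)"
      by (intro tendsto_scaleR tendsto_const LIMSEQ_Suc[OF lim_1_over_n])
    from banach_lattice_limit_ge[OF this le] show "y \<le> 0" by simp
  qed
  ultimately have small: "\<exists>d\<in>D. \<forall>z\<in>D. z \<le> d \<longrightarrow> norm z < e" if "0 < e" for e
    using order_continuous_normD[OF ocn] that by blast
  have "Cauchy x"
  proof (rule metric_CauchyI)
    fix e :: real assume "0 < e"
    then obtain d where d: "d \<in> D" "\<And>z. z \<in> D \<Longrightarrow> z \<le> d \<Longrightarrow> norm z < e / 2"
      using small[of "e / 2"] by auto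
    obtain c n where c: "d = c - x n" "\<And>m. x m \<le> c" using d(1) by (auto simp: D_def)
    have close: "norm (c - x m) < e / 2" if "n \<le> m" for m
      using d(2)[OF D[OF c(2)], of m] inc that c(1) by (simp add: incseq_def diff_left_mono)
    have "dist (x m) (x k) < e" if "n \<le> m" "n \<le> k" for m k
      using norm_triangle_ineq4[of "c - x k" "c - x m"] close[OF that(1)] close[OF that(2)]
      by (simp add: dist_norm)
    then show "\<exists>M. \<forall>m\<ge>M. \<forall>k\<ge>M. dist (x m) (x k) < e" by blast
  qed
  then show "convergent x" by (rule Cauchy_convergent)
qed

text \<open>A tail hull point of an increasing sequence dominates all terms, and the convex combinations
  approximating it are eventually dominated by the terms.\<close>

lemma incseq_tail_hull_point_limit:
  fixes x :: "nat \<Rightarrow> 'a::banach_lattice"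
  assumes inc: "incseq x" and v: "tail_hull_point x v"
  shows "x \<longlonglongrightarrow> v"
proof -
  have le_v: "x n \<le> v" for n
  proof -
    have "closure (convex hull (x ` {n..})) \<subseteq> {y. x n \<le> y}"
      using inc by (intro closure_minimal hull_minimal closed_atLeast_lattice convex_atLeast_lattice)
        (auto simp: incseq_def)
    then show ?thesis using v unfolding tail_hull_point_def by blast
  qed
  have dominated: "convex hull (x ` {0..}) \<subseteq> {c. \<exists>N. c \<le> x N}"
  proof (rule hull_minimal)
    show "convex {c. \<exists>N. c \<le> x N}"
    proof (rule convexI)
      fix c d and s t :: real
      assume "c \<in> {c. \<exists>N. c \<le> x N}" "d \<in> {c. \<exists>N. c \<le> x N}" and st: "0 \<le> s" "0 \<le> t" "s + t = 1"
      then obtain M N where "c \<le> x M" "d \<le> x N" by blast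
      then have "c \<le> x (max M N)" "d \<le> x (max M N)"
        using incseqD[OF inc, of M "max M N"] incseqD[OF inc, of N "max M N"] by (auto intro: order_trans)
      then have "s *\<^sub>R c + t *\<^sub>R d \<le> s *\<^sub>R x (max M N) + t *\<^sub>R x (max M N)"
        using st by (intro add_mono scaleR_left_mono) auto
      then show "s *\<^sub>R c + t *\<^sub>R d \<in> {c. \<exists>N. c \<le> x N}"
        using st by (auto simp flip: scaleR_left_distrib)
    qed
  qed auto
  show ?thesis
  proof (rule metric_LIMSEQ_I)
    fix e :: real assume "0 < e"
    then obtain c where c: "c \<in> convex hull (x ` {0..})" "dist c v < e"
      using v unfolding tail_hull_point_def closure_approachable by blast
    then obtain N where N: "c \<le> x N" using dominated by blast
    have "dist (x n) v < e" if "N \<le> n" for n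
    proof -
      have "c \<le> x n" using N incseqD[OF inc that] by (rule order_trans)
      then have "norm (v - x n) \<le> norm (v - c)"
        using le_v[of n] by (intro norm_mono_pos) (auto intro: diff_left_mono)
      then show ?thesis using c(2) by (simp add: dist_norm norm_minus_commute)
    qed
    then show "\<exists>N. \<forall>n\<ge>N. dist (x n) v < e" by blast
  qed
qed

lemma reflexive_imp_monotone_convergence:
  assumes "reflexive_space (scaleR :: real \<Rightarrow> 'a \<Rightarrow> 'a::banach_lattice)"
  shows "monotone_convergence_norm TYPE('a)"
  unfolding monotone_convergence_norm_def
proof (intro allI impI)
  fix x :: "nat \<Rightarrow> 'a" and b
  assume inc: "incseq x" and b: "\<forall>n. x n \<le> b"
  have "norm (x n) \<le> norm (b - x 0) + norm (x 0)" for n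
  proof -
    have "norm (x n - x 0) \<le> norm (b - x 0)"
      using inc b by (intro norm_mono_pos) (auto simp: incseq_def diff_right_mono)
    then show ?thesis using norm_triangle_ineq[of "x n - x 0" "x 0"] by simp
  qed
  then obtain v where "tail_hull_point x v" using reflexive_imp_tail_hull_point[OF assms] by blast
  with inc have "x \<longlonglongrightarrow> v" by (rule incseq_tail_hull_point_limit)
  then show "convergent x" by (auto simp: convergent_def)
qed

section \<open>Limits superior of sequences in an order interval\<close>

primrec tail_sup :: "(nat \<Rightarrow> 'a::lattice) \<Rightarrow> nat \<Rightarrow> nat \<Rightarrow> 'a" where
  "tail_sup p k 0 = p k"
| "tail_sup p k (Suc m) = sup (tail_sup p k m) (p (k + Suc m))"

lemma tail_sup_le: "(\<And>n. k \<le> n \<Longrightarrow> p n \<le> b) \<Longrightarrow> tail_sup p k m \<le> b"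
  by (induction m) auto

lemma incseq_tail_sup: "incseq (tail_sup p k)"
  by (rule incseq_SucI) simp

lemma le_tail_sup: "k \<le> n \<Longrightarrow> p n \<le> tail_sup p k (n - k)"
  by (cases "n - k") (auto simp: le_imp_diff_is_add add.commute)

text \<open>Every \<open>s k\<close> dominates \<open>p k\<close>, hence has norm at least \<open>d\<close>, and this bound passes to
  the norm limit \<open>w\<close>, which is the limit superior of the sequence.\<close>

lemma limsup_nonzero:
  fixes p :: "nat \<Rightarrow> 'a::banach_lattice"
  assumes mc: "monotone_convergence_norm TYPE('a)"
    and p: "\<And>n. 0 \<le> p n" "\<And>n. p n \<le> u" "\<And>n. d \<le> norm (p n)"
  obtains s w where "\<And>k. tail_sup p k \<longlonglongrightarrow> s k" "\<And>k m. tail_sup p k m \<le> s k" "s \<longlonglongrightarrow> w"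
    "\<And>k. w \<le> s k" "0 \<le> w" "d \<le> norm w"
proof -
  have "\<exists>l. tail_sup p k \<longlonglongrightarrow> l \<and> (\<forall>m. tail_sup p k m \<le> l)" for k
    by (rule monotone_convergence_incseq[OF mc incseq_tail_sup, of p k u]) (auto intro: tail_sup_le p)
  then obtain s where s: "\<And>k. tail_sup p k \<longlonglongrightarrow> s k" "\<And>k m. tail_sup p k m \<le> s k" by metis
  have p_s: "p n \<le> s k" if "k \<le> n" for n k
    using le_tail_sup[OF that, of p] s(2)[of k "n - k"] by (rule order_trans)
  have "decseq s"
  proof (rule decseq_SucI)
    fix k
    show "s (Suc k) \<le> s k"
      by (rule banach_lattice_limit_le[OF s(1)], rule tail_sup_le, rule p_s) simp
  qed
  moreover have s0: "0 \<le> s k" for k using p(1)[of k] p_s[of k k] by simp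
  ultimately obtain w where w: "s \<longlonglongrightarrow> w" "\<And>k. w \<le> s k" "0 \<le> w"
    by (rule monotone_convergence_decseq[OF mc]) blast
  have "d \<le> norm (s k)" for k
    using p(3)[of k] norm_mono_pos[OF p(1) p_s[of k k]] by simp
  then have "d \<le> norm w" using LIMSEQ_le_const[OF tendsto_norm[OF w(1)]] by blast
  then show ?thesis using that s w by blast
qed

text \<open>An abstract form of the fact that sets of measure at least \<open>d\<close> in a probability space have a
  subsequence with finite intersections of positive measure: a nonzero part of the limit superior
  meets some later member of the sequence, and one continues with their infimum.\<close>

lemma finitely_meeting_subsequence:
  fixes p :: "nat \<Rightarrow> 'a::banach_lattice"
  assumes mc: "monotone_convergence_norm TYPE('a)"
    and p: "\<And>n. 0 \<le> p n" "\<And>n. p n \<le> u" "\<And>n. d \<le> norm (p n)" and d: "0 < d"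
  obtains r :: "nat \<Rightarrow> nat" where "strict_mono r"
    "\<And>k. \<exists>z. 0 \<le> z \<and> z \<noteq> 0 \<and> (\<forall>i\<le>k. z \<le> p (r i))"
proof -
  obtain s w where s: "\<And>k. tail_sup p k \<longlonglongrightarrow> s k" "\<And>k m. tail_sup p k m \<le> s k"
    and w: "\<And>k. w \<le> s k" "0 \<le> w" "d \<le> norm w"
    by (rule limsup_nonzero[of p u d, OF mc p(1) p(2) p(3)]) blast
  have meet: "\<exists>n\<ge>k. inf z (p n) \<noteq> 0" if z: "0 \<le> z" "z \<le> w" "z \<noteq> 0" for z k
  proof (rule ccontr)
    assume "\<not> ?thesis"
    then have zero: "inf z (p n) = 0" if "k \<le> n" for n using that by blast
    have dis: "0 \<le> tail_sup p k m \<and> inf z (tail_sup p k m) = 0" for m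
    proof (induction m)
      case 0 then show ?case using zero p by simp
    next
      case (Suc m)
      let ?t = "tail_sup p k m" and ?q = "p (k + Suc m)"
      have "inf z (?t + ?q) = 0" using Suc z p zero by (intro disjoint_add) auto
      moreover have "sup ?t ?q \<le> ?t + ?q"
        using Suc p by (intro sup_least) (simp_all add: add_increasing2 add_increasing)
      ultimately have "inf z (sup ?t ?q) \<le> 0" by (metis inf_mono order_refl)
      moreover have "0 \<le> sup ?t ?q" using Suc by (simp add: le_supI1)
      ultimately show ?case using z by (simp add: antisym)
    qed
    have "norm z \<le> norm (s k - tail_sup p k m)" for m
    proof (rule norm_mono_pos)
      have "z = pprt (z - tail_sup p k m)" using dis by (simp add: pprt_diff_eq)
      also have "\<dots> \<le> s k - tail_sup p k m"
        using z(2) w(1)[of k] s(2)[of k m] unfolding pprt_def by (intro sup_least) (auto intro: diff_right_mono order_trans)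
      finally show "z \<le> s k - tail_sup p k m" .
    qed (rule z)
    moreover have "(\<lambda>m. norm (s k - tail_sup p k m)) \<longlonglongrightarrow> 0"
      using tendsto_norm[OF tendsto_diff[OF tendsto_const s(1)], of "s k" k] by simp
    ultimately have "norm z \<le> 0" by (intro LIMSEQ_le_const) auto
    then show False using z by simp
  qed
  define P where "P = (\<lambda>(n, z). 0 \<le> z \<and> z \<le> w \<and> z \<noteq> 0 \<and> z \<le> p n)"
  define Q where "Q = (\<lambda>(n :: nat, z :: 'a) (n', z'). n < n' \<and> z' \<le> z)"
  have step: "\<exists>n z'. k \<le> n \<and> P (n, z') \<and> z' \<le> z" if z: "0 \<le> z" "z \<le> w" "z \<noteq> 0" for z k
  proof -
    obtain n where "k \<le> n" "inf z (p n) \<noteq> 0" using meet[OF z] by blast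
    then show ?thesis using z p by (intro exI[of _ n] exI[of _ "inf z (p n)"]) (auto simp: P_def intro: le_infI1)
  qed
  have "w \<noteq> 0" using w(3) d by auto
  obtain f where f: "\<And>j. P (f j)" "\<And>j. Q (f j) (f (Suc j))"
  proof (rule dependent_nat_choice[of "\<lambda>_. P" "\<lambda>_. Q", THEN exE])
    show "\<exists>x. P x" using step[of w 0] w \<open>w \<noteq> 0\<close> by auto
    show "\<exists>y. P y \<and> Q x y" if "P x" for x
      using that step[of "snd x" "Suc (fst x)"] by (auto simp: P_def Q_def Suc_le_eq split_beta)
  qed blast
  have "strict_mono (fst \<circ> f)"
    by (rule strict_mono_Suc_iff[THEN iffD2]) (use f(2) in \<open>auto simp: Q_def split_beta\<close>)
  moreover have "\<exists>z. 0 \<le> z \<and> z \<noteq> 0 \<and> (\<forall>i\<le>k. z \<le> p ((fst \<circ> f) i))" for k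
  proof (intro exI[of _ "snd (f k)"] conjI allI impI)
    fix i assume "i \<le> k"
    have "decseq (snd \<circ> f)"
      by (rule decseq_SucI) (use f(2) in \<open>auto simp: Q_def split_beta\<close>)
    then have "snd (f k) \<le> snd (f i)" using \<open>i \<le> k\<close> by (simp add: decseq_def)
    also have "\<dots> \<le> p ((fst \<circ> f) i)" using f(1)[of i] by (auto simp: P_def split_beta)
    finally show "snd (f k) \<le> p ((fst \<circ> f) i)" .
  qed (use f(1)[of k] in \<open>auto simp: P_def split_beta\<close>)
  ultimately show ?thesis using that by blast
qed

section \<open>Strictly positive functionals on countable sets\<close>

lemma pprt_scaleR: "0 \<le> c \<Longrightarrow> pprt (c *\<^sub>R x) = c *\<^sub>R pprt x" for x :: "'a::banach_lattice"
proof (cases "c = 0")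
  case False
  assume "0 \<le> c"
  with False have c: "0 < c" by simp
  have le: "pprt (c *\<^sub>R x) \<le> c *\<^sub>R pprt x" if "0 < c" for c and x :: 'a
  proof -
    have "c *\<^sub>R x \<le> c *\<^sub>R pprt x" "0 \<le> c *\<^sub>R pprt x"
      using that by (auto intro!: scaleR_left_mono scaleR_nonneg_nonneg simp: pprt_def)
    then show ?thesis unfolding pprt_def[of "c *\<^sub>R x"] by (rule sup_least)
  qed
  have "c *\<^sub>R pprt (inverse c *\<^sub>R (c *\<^sub>R x)) \<le> c *\<^sub>R (inverse c *\<^sub>R pprt (c *\<^sub>R x))"
    using c by (intro scaleR_left_mono le) auto
  with le[OF c, of x] c show ?thesis by (simp add: antisym)
qed simp

lemma norm_pprt_le: "norm (pprt x) \<le> norm x" for x :: "'a::banach_lattice"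
  by (rule norm_mono_abs) (simp add: pprt_le_abs)

lemma sublinear_norm_pprt: "sublinear (\<lambda>x :: 'a::banach_lattice. norm (pprt x))"
proof (rule sublinearI)
  fix x y :: 'a
  have "norm (pprt (x + y)) \<le> norm (pprt x + pprt y)"
    by (intro norm_mono_pos pprt_add_le) simp
  then show "norm (pprt (x + y)) \<le> norm (pprt x) + norm (pprt y)"
    using norm_triangle_ineq order_trans by blast
qed (simp_all add: pprt_scaleR)

text \<open>The Hahn-Banach theorem for the sublinear functional \<open>x \<mapsto> norm (pprt x)\<close> gives positive
  functionals norming the single elements of \<open>Q\<close>, and \<open>\<phi>\<close> is their sum with geometric weights.
  If \<open>\<phi> w = 0\<close>, then all of them vanish at \<open>w\<close>.  The conclusion is stated in terms of the
  distance from \<open>q\<close> to \<open>w\<close> because it will be used for norm limits \<open>w\<close> of elements of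
  \<open>Q\<close>, on which \<open>\<phi>\<close> is therefore strictly positive.\<close>

lemma countable_strictly_positive_functional:
  fixes Q :: "'a::banach_lattice set"
  assumes Q: "countable Q" "Q \<noteq> {}" "\<And>q. q \<in> Q \<Longrightarrow> 0 \<le> q"
  obtains \<phi> :: "'a \<Rightarrow> real" where "bounded_linear \<phi>" "\<And>x. 0 \<le> x \<Longrightarrow> 0 \<le> \<phi> x"
    "\<And>q w. q \<in> Q \<Longrightarrow> 0 \<le> w \<Longrightarrow> \<phi> w = 0 \<Longrightarrow> norm q \<le> norm (q - w)"
proof -
  define q where "q = from_nat_into Q"
  have Q_q: "Q = range q" unfolding q_def using Q by (simp add: range_from_nat_into)
  have "\<exists>f. linear f \<and> (\<forall>x. f x \<le> norm (pprt x)) \<and> f (q i) = norm (pprt (q i))" for i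
    by (rule hahn_banach[OF sublinear_norm_pprt, of "q i"]) blast
  then obtain f where f: "\<And>i. linear (f i)" "\<And>i x. f i x \<le> norm (pprt x)"
      "\<And>i. f i (q i) = norm (pprt (q i))" by metis
  have fq: "f i (q i) = norm (q i)" for i using f(3) Q(3) Q_q by simp
  have f_le: "f i x \<le> norm x" for i x using f(2)[of i x] norm_pprt_le[of x] by simp
  have f_pos: "0 \<le> f i x" if "0 \<le> x" for i x
    using f(2)[of i "- x"] that linear_neg[OF f(1), of i x] by simp
  have f_abs: "\<bar>f i x\<bar> \<le> norm x" for i x
    using f_le[of i x] f_le[of i "- x"] linear_neg[OF f(1), of i x] by simp
  have summ: "summable (\<lambda>i. (1/2) ^ i * f i x)" for x
  proof (rule summable_comparison_test')
    show "summable (\<lambda>i. (1/2::real) ^ i * norm x)" by (intro summable_mult2 summable_geometric) simp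
    show "norm ((1/2) ^ i * f i x) \<le> (1/2) ^ i * norm x" if "i \<ge> 0" for i
      using f_abs[of i x] by (simp add: abs_mult divide_right_mono mult_left_mono)
  qed
  define \<phi> where "\<phi> x = (\<Sum>i. (1/2) ^ i * f i x)" for x
  have "bounded_linear \<phi>"
  proof (rule bounded_linear_intro)
    fix x y and c :: real
    show "\<phi> (x + y) = \<phi> x + \<phi> y"
      unfolding \<phi>_def suminf_add[OF summ summ] by (simp add: linear_add[OF f(1)] algebra_simps)
    show "\<phi> (c *\<^sub>R x) = c *\<^sub>R \<phi> x"
      unfolding \<phi>_def using suminf_mult[OF summ, of c x] by (simp add: linear_scale[OF f(1)] algebra_simps)
    have "\<phi> x \<le> norm x * 2" for x
    proof -
      have "\<phi> x \<le> (\<Sum>i. (1/2::real) ^ i * norm x)"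
        unfolding \<phi>_def using f_le
        by (intro suminf_le summ mult_left_mono summable_mult2 summable_geometric) auto
      also have "\<dots> = norm x * 2" by (subst suminf_mult2[symmetric]) (auto simp: suminf_geometric)
      finally show ?thesis .
    qed
    from this[of x] this[of "- x"] show "norm (\<phi> x) \<le> norm x * 2"
      unfolding \<phi>_def using suminf_minus[OF summ[of x]] by (simp add: linear_neg[OF f(1)] abs_le_iff)
  qed
  moreover have "0 \<le> \<phi> x" if "0 \<le> x" for x
    unfolding \<phi>_def using f_pos[OF that] by (intro suminf_nonneg summ) simp
  moreover have "norm p \<le> norm (p - w)" if p: "p \<in> Q" and w: "0 \<le> w" "\<phi> w = 0" for p w
  proof -
    have "(1/2) ^ i * f i w = 0" for i
      using suminf_eq_zero_iff[OF summ[of w]] f_pos[OF w(1)] w(2) unfolding \<phi>_def by simp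
    then have zero: "f i w = 0" for i by (metis mult_eq_0_iff power_not_zero zero_neq_numeral divide_eq_0_iff zero_neq_one)
    obtain i where i: "p = q i" using p Q_q by blast
    have "norm p = f i (p - w)" using fq[of i] zero[of i] linear_diff[OF f(1), of i p w] i by simp
    also have "\<dots> \<le> norm (p - w)" by (rule f_le)
    finally show ?thesis .
  qed
  ultimately show ?thesis using that by blast
qed

text \<open>A Borel-Cantelli argument: if the norms stayed above \<open>e\<close>, the limit superior \<open>w\<close> of the
  sequence would have norm at least \<open>e\<close>, although the summable bound forces \<open>\<phi> w = 0\<close>.\<close>

lemma strictly_positive_functional_controls_norm:
  fixes p :: "nat \<Rightarrow> 'a::banach_lattice" and \<phi> :: "'a \<Rightarrow> real"
  assumes mc: "monotone_convergence_norm TYPE('a)"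
    and \<phi>: "bounded_linear \<phi>" "\<And>x. 0 \<le> x \<Longrightarrow> 0 \<le> \<phi> x"
      "\<And>q w. q \<in> Q \<Longrightarrow> 0 \<le> w \<Longrightarrow> \<phi> w = 0 \<Longrightarrow> norm q \<le> norm (q - w)"
    and Q: "\<And>a b. a \<in> Q \<Longrightarrow> b \<in> Q \<Longrightarrow> sup a b \<in> Q"
    and p: "\<And>n. p n \<in> Q" "\<And>n. 0 \<le> p n" "\<And>n. p n \<le> u"
    and small: "\<And>n. \<phi> (p n) \<le> (1/2) ^ n" and e: "0 < e"
  shows "\<exists>n. norm (p n) < e"
proof (rule ccontr)
  assume "\<not> ?thesis"
  then have large: "e \<le> norm (p n)" for n by (simp add: not_less)
  obtain s w where s: "\<And>k. tail_sup p k \<longlonglongrightarrow> s k" "s \<longlonglongrightarrow> w"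
    and w: "\<And>k. w \<le> s k" "0 \<le> w"
    by (rule limsup_nonzero[of p u e, OF mc p(2) p(3) large]) blast
  interpret \<phi>: bounded_linear \<phi> by fact
  have mono: "\<phi> x \<le> \<phi> y" if "x \<le> y" for x y
    using \<phi>(2)[of "y - x"] that \<phi>.diff[of y x] by simp
  have nonneg: "0 \<le> tail_sup p k m" for k m by (induction m) (auto simp: p(2) le_supI1)
  have bound: "\<phi> (tail_sup p k m) \<le> 2 * (1/2) ^ k - (1/2) ^ (k + m)" for k m
  proof (induction m)
    case 0 show ?case using small[of k] by simp
  next
    case (Suc m)
    have "tail_sup p k (Suc m) \<le> tail_sup p k m + p (k + Suc m)"
      using nonneg p(2) by (auto intro!: sup_least simp: add_increasing add_increasing2)
    from mono[OF this] have "\<phi> (tail_sup p k (Suc m)) \<le> \<phi> (tail_sup p k m) + \<phi> (p (k + Suc m))"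
      by (simp only: \<phi>.add)
    moreover have "(1/2::real) ^ (k + m) = 2 * (1/2) ^ (k + Suc m)" by simp
    ultimately show ?case using Suc small[of "k + Suc m"] by linarith
  qed
  have "\<phi> w \<le> 2 * (1/2) ^ k" for k
  proof -
    have "\<phi> (tail_sup p k m) \<le> 2 * (1/2) ^ k" for m
      using bound[of k m] zero_le_power[of "1/2::real" "k + m"] by linarith
    then have "\<phi> (s k) \<le> 2 * (1/2) ^ k"
      using LIMSEQ_le_const2[OF \<phi>.tendsto[OF s(1)]] by blast
    with mono[OF w(1)[of k]] show ?thesis by simp
  qed
  moreover have "(\<lambda>k. 2 * (1/2::real) ^ k) \<longlonglongrightarrow> 2 * 0"
    by (intro tendsto_mult_left LIMSEQ_power_zero) simp
  ultimately have "\<phi> w \<le> 0" using LIMSEQ_le_const by fastforce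
  then have w0: "\<phi> w = 0" using \<phi>(2)[OF w(2)] by simp
  obtain k where k: "dist (s k) w < e / 2"
    using metric_LIMSEQ_D[OF s(2), of "e / 2"] e by auto
  obtain m where m: "dist (tail_sup p k m) (s k) < e / 2"
    using metric_LIMSEQ_D[OF s(1)[of k], of "e / 2"] e by auto
  have "tail_sup p k m \<in> Q" by (induction m) (simp_all add: p(1) Q)
  from \<phi>(3)[OF this w(2) w0] have "norm (tail_sup p k m) < e"
    using k m dist_triangle[of "tail_sup p k m" w "s k"] by (simp add: dist_norm)
  moreover have "norm (p k) \<le> norm (tail_sup p k m)"
  proof (rule norm_mono_pos[OF p(2)])
    show "p k \<le> tail_sup p k m" using incseqD[OF incseq_tail_sup[of p k], of 0 m] by simp
  qed
  ultimately show False using large[of k] by simp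
qed

section \<open>Order bounded sequences\<close>

text \<open>For functions this vanishes outside the set where \<open>b < r u < a\<close>.\<close>

definition crossing :: "'a::banach_lattice \<Rightarrow> real \<Rightarrow> 'a \<Rightarrow> 'a \<Rightarrow> 'a" where
  "crossing u r a b = inf (pprt (a - r *\<^sub>R u)) (pprt (r *\<^sub>R u - b))"

lemma crossing_nonneg: "0 \<le> crossing u r a b"
  by (simp add: crossing_def)

text \<open>The function \<open>z \<mapsto> pprt (z - r u)\<close> is convex with a kink at level \<open>r\<close>, which a segment
  from \<open>b\<close> to \<open>a\<close> passes exactly where the crossing lives.  With \<open>A = a - r u\<close> and
  \<open>B = b - r u\<close> the claim says that adding \<open>inf (pprt A) (pprt (- B))\<close> to \<open>A + B\<close> or to \<open>0\<close>
  does not exceed \<open>pprt A + pprt B\<close>.\<close>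

lemma crossing_le_convexity_defect:
  "crossing u r a b \<le> pprt (a - r *\<^sub>R u) + pprt (b - r *\<^sub>R u) - 2 *\<^sub>R pprt (midpoint a b - r *\<^sub>R u)"
proof -
  define A B where "A = a - r *\<^sub>R u" and "B = b - r *\<^sub>R u"
  have "2 *\<^sub>R pprt (midpoint a b - r *\<^sub>R u) = pprt (A + B)"
  proof -
    have "(r * 2) *\<^sub>R u = r *\<^sub>R u + r *\<^sub>R u" by (simp flip: scaleR_left_distrib)
    then show ?thesis
      unfolding A_def B_def by (subst pprt_scaleR[symmetric]) (auto simp: midpoint_def algebra_simps)
  qed
  moreover have "crossing u r a b + pprt (A + B) \<le> pprt A + pprt B"
  proof -
    have m: "crossing u r a b = inf (pprt A) (pprt (- B))" by (simp add: crossing_def A_def B_def)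
    have "crossing u r a b + (A + B) \<le> pprt (- B) + (pprt A + B)"
      unfolding m by (intro add_mono inf_le2) (simp_all add: pprt_def)
    also have "\<dots> = pprt A + pprt B" by (subst (2) pprt_add_pprt_minus) (simp add: add.commute add.left_commute)
    finally have 1: "crossing u r a b + (A + B) \<le> pprt A + pprt B" .
    have "crossing u r a b + 0 \<le> pprt A + pprt B" unfolding m by (intro add_mono) auto
    with 1 show ?thesis unfolding pprt_def[of "A + B"] add_sup_distrib_left by (intro sup_least)
  qed
  ultimately show ?thesis by (simp add: A_def B_def le_diff_eq)
qed

text \<open>Conversely, finitely many levels at distance \<open>h\<close> detect \<open>pprt (a - b)\<close> up to \<open>h u\<close>.  The
  proof cuts \<open>a - h u\<close> and \<open>b\<close> into horizontal layers of height \<open>h\<close> and compares layer by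
  layer; lowering \<open>a\<close> by one layer makes the crossings of \<open>a\<close> and \<open>b\<close> occur at the same
  level.\<close>

lemma pprt_diff_le_sum_crossings:
  fixes u a b :: "'a::banach_lattice"
  assumes u: "0 \<le> u" and a: "a \<le> u" and b: "- u \<le> b" "b \<le> u" and M: "0 < M" and h: "h = 2 / real M"
  shows "pprt (a - b) \<le> h *\<^sub>R u + (\<Sum>i<M. crossing u (real (Suc i) * h - 1) a b)"
proof -
  define G where "G i = pprt (a - (real (Suc i) * h - 1) *\<^sub>R u) - pprt (b - (real i * h - 1) *\<^sub>R u)" for i :: nat
  have h0: "0 \<le> h" "real M * h = 2" using M h by auto
  have hu: "0 \<le> h *\<^sub>R u" using h0 u by (simp add: scaleR_nonneg_nonneg)
  have step: "G i - G (Suc i) \<le> crossing u (real (Suc i) * h - 1) a b" for i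
  proof -
    define A B where "A = a - (real (Suc i) * h - 1) *\<^sub>R u" and "B = b - (real i * h - 1) *\<^sub>R u"
    have G: "G i - G (Suc i) = (pprt A - pprt (A - h *\<^sub>R u)) - (pprt B - pprt (B - h *\<^sub>R u))"
    proof -
      have "(h * 2) *\<^sub>R u = h *\<^sub>R u + h *\<^sub>R u" by (simp flip: scaleR_left_distrib)
      then show ?thesis unfolding G_def A_def B_def by (simp add: algebra_simps)
    qed
    have c: "crossing u (real (Suc i) * h - 1) a b = inf (pprt A) (pprt (h *\<^sub>R u - B))"
      unfolding crossing_def A_def B_def by (simp add: algebra_simps)
    have "pprt (B - h *\<^sub>R u) \<le> pprt B" using hu by (intro pprt_mono) (simp add: diff_le_eq)
    moreover have "0 \<le> pprt (A - h *\<^sub>R u)" by simp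
    ultimately have "(pprt A - pprt (A - h *\<^sub>R u)) - (pprt B - pprt (B - h *\<^sub>R u)) \<le> (pprt A - 0) - 0"
      by (intro diff_mono) auto
    then have 1: "G i - G (Suc i) \<le> pprt A" unfolding G by simp
    have "pprt A \<le> pprt (A - h *\<^sub>R u) + h *\<^sub>R u"
      using pprt_add_le[of "A - h *\<^sub>R u" "h *\<^sub>R u"] hu by simp
    then have "pprt A - pprt (A - h *\<^sub>R u) \<le> h *\<^sub>R u" by (simp add: diff_le_eq add.commute)
    then have "G i - G (Suc i) \<le> h *\<^sub>R u - (pprt B - pprt (B - h *\<^sub>R u))"
      unfolding G by (rule diff_right_mono)
    also have "\<dots> = (B - pprt B) + pprt (h *\<^sub>R u - B)"
      by (subst pprt_add_pprt_minus[of "B - h *\<^sub>R u"]) simp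
    also have "\<dots> \<le> 0 + pprt (h *\<^sub>R u - B)" unfolding add_le_cancel_right diff_le_0_iff_le by (simp add: pprt_def)
    finally have "G i - G (Suc i) \<le> pprt (h *\<^sub>R u - B)" by simp
    with 1 show ?thesis unfolding c by (intro inf_greatest)
  qed
  have "a - b - h *\<^sub>R u = (a - h *\<^sub>R u + u) - (b + u)" by simp
  also have "\<dots> \<le> pprt (a - h *\<^sub>R u + u) - (b + u)" by (intro diff_right_mono) (simp add: pprt_def)
  also have "\<dots> = G 0"
    using b(1) by (simp add: G_def algebra_simps minus_le_iff add.commute) (metis add.commute add_increasing2 diff_ge_0_iff_ge diff_minus_eq_add pprt_eq_id)
  also have "\<dots> = G 0 - G M"
  proof -
    have "a \<le> u + h *\<^sub>R u" using a hu by (simp add: add_increasing2)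
    then have "pprt (a - (real (Suc M) * h - 1) *\<^sub>R u) = 0" "pprt (b - (real M * h - 1) *\<^sub>R u) = 0"
      using b(2) h0 by (simp_all add: distrib_right scaleR_left_distrib add.commute)
    then show ?thesis by (simp add: G_def)
  qed
  also have "\<dots> = (\<Sum>i<M. G i - G (Suc i))" by (simp add: sum_lessThan_telescope')
  also have "\<dots> \<le> (\<Sum>i<M. crossing u (real (Suc i) * h - 1) a b)" by (intro sum_mono step)
  finally have "a - b \<le> h *\<^sub>R u + (\<Sum>i<M. crossing u (real (Suc i) * h - 1) a b)"
    by (simp add: diff_le_eq add.commute)
  moreover have "0 \<le> h *\<^sub>R u + (\<Sum>i<M. crossing u (real (Suc i) * h - 1) a b)"
    using hu by (intro add_nonneg_nonneg sum_nonneg crossing_nonneg)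
  ultimately show ?thesis unfolding pprt_def[of "a - b"] by (intro sup_least)
qed

lemma op_closure_midpoint_subset:
  assumes "convex C" "A \<subseteq> C"
  shows "op_closure midpoint A \<subseteq> C"
proof
  fix x assume "x \<in> op_closure midpoint A"
  then show "x \<in> C"
  proof induction
    case (op a b)
    then have "(1/2) *\<^sub>R a + (1/2) *\<^sub>R b \<in> C" by (intro convexD[OF assms(1)]) auto
    then show ?case by (simp add: midpoint_def scaleR_add_right)
  qed (use assms(2) in blast)
qed

text \<open>A sum of convex functions controls the convexity defect of each summand.\<close>

lemma midpoint_convex_series:
  fixes h :: "nat \<Rightarrow> 'a::real_vector \<Rightarrow> real"
  assumes summ: "\<And>x. x \<in> C \<Longrightarrow> summable (\<lambda>j. h j x)"
    and ab: "a \<in> C" "b \<in> C" "midpoint a b \<in> C"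
    and conv: "\<And>j. 0 \<le> h j a + h j b - 2 * h j (midpoint a b)"
  shows "h j a + h j b - 2 * h j (midpoint a b)
    \<le> (\<Sum>j. h j a) + (\<Sum>j. h j b) - 2 * (\<Sum>j. h j (midpoint a b))"
proof -
  have s: "(\<lambda>j. h j a + h j b - 2 * h j (midpoint a b)) sums
      ((\<Sum>j. h j a) + (\<Sum>j. h j b) - 2 * (\<Sum>j. h j (midpoint a b)))"
    by (intro sums_diff sums_add sums_mult summable_sums summ ab)
  then have "summable (\<lambda>j. h j a + h j b - 2 * h j (midpoint a b))" by (rule sums_summable)
  from sum_le_suminf[OF this, of "{j}"] conv show ?thesis using sums_unique[OF s] by simp
qed

text \<open>A form of the weak compactness of order intervals, proved like the existence of nearest points
  in a uniformly convex space.  The convex function to be minimised is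
  \<open>H z = \<Sum>j. 2^(-j) \<phi> (pprt (z - r j u))\<close>, with \<open>r\<close> running through the rational levels in
  \<open>[-1, 1]\<close>.  The infima of \<open>H\<close> over the tails increase and converge, so that the convexity
  defects of almost minimal points \<open>z k\<close> tend to \<open>0\<close>; hence so do their crossings at each level,
  first under \<open>\<phi>\<close> and then in norm, and \<open>z\<close> is a Cauchy sequence.

  The functional \<open>\<phi>\<close> must be strictly positive on the crossings of points that are chosen only
  after \<open>\<phi>\<close>.  Therefore the minimisation takes place over the countable sets \<open>C k\<close> of iterated
  midpoints, which are already fixed by the sequence.\<close>

lemma order_bounded_imp_tail_hull_point:
  fixes y :: "nat \<Rightarrow> 'a::banach_lattice"
  assumes mc: "monotone_convergence_norm TYPE('a)"
    and y: "\<And>n. \<bar>y n\<bar> \<le> u"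
  shows "\<exists>v. tail_hull_point y v"
proof -
  have u: "0 \<le> u" using order_trans[OF abs_ge_zero y[of 0]] .
  define C where "C k = op_closure midpoint (y ` {k..})" for k
  have C_mid: "midpoint a b \<in> C k" if "a \<in> C k" "b \<in> C k" for a b k
    using that unfolding C_def by (rule op_closure.op)
  have C_hull: "C k \<subseteq> convex hull (y ` {k..})" for k
    unfolding C_def by (rule op_closure_midpoint_subset[OF convex_convex_hull hull_subset])
  have C_anti: "C l \<subseteq> C k" if "k \<le> l" for k l
    unfolding C_def by (rule op_closure_mono) (use that in auto)
  have C_ne: "C k \<noteq> {}" for k unfolding C_def by (auto intro: op_closure.base)
  have C_u: "- u \<le> a" "a \<le> u" if "a \<in> C k" for a k
  proof -
    have "C k \<subseteq> {z. - u \<le> z}" unfolding C_def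
      using y by (intro op_closure_midpoint_subset convex_atLeast_lattice) (auto simp: abs_le_iff minus_le_iff)
    moreover have "C k \<subseteq> {z. z \<le> u}" unfolding C_def
      using y by (intro op_closure_midpoint_subset convex_atMost_lattice) (auto simp: abs_le_iff)
    ultimately show "- u \<le> a" "a \<le> u" using that by auto
  qed
  define R where "R = \<rat> \<inter> {-1..1::real}"
  define r where "r = from_nat_into R"
  have "countable R" "R \<noteq> {}" unfolding R_def by (auto simp: countable_rat intro!: countable_Int1)
  then have R_r: "R = range r" unfolding r_def by (simp add: range_from_nat_into)
  have r: "- 1 \<le> r j" "r j \<le> 1" for j
  proof -
    have "r j \<in> R" using R_r by blast
    then show "- 1 \<le> r j" "r j \<le> 1" by (auto simp: R_def)
  qed
  have level: "pprt (a - r j *\<^sub>R u) \<le> 2 *\<^sub>R u" if "a \<in> C k" for a j k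
  proof -
    have "(- r j) *\<^sub>R u \<le> 1 *\<^sub>R u" using r[of j] u by (intro scaleR_right_mono) auto
    then have "a - r j *\<^sub>R u \<le> u + u" using C_u(2)[OF that] add_mono[of a u "- (r j *\<^sub>R u)" u] by simp
    then show ?thesis unfolding pprt_def using u by (intro sup_least) (simp_all add: scaleR_2)
  qed
  \<comment> \<open>Closing the crossings under suprema puts their tail suprema into \<open>Q\<close>, and the limit
     superior of a sequence of crossings is a norm limit of those.\<close>
  define P where "P = (\<lambda>(a, b, j). crossing u (r j) a b) ` (C 0 \<times> C 0 \<times> UNIV)"
  define Q where "Q = op_closure sup P"
  have "countable (C 0)" unfolding C_def by (intro countable_op_closure) simp
  then have "countable Q" unfolding Q_def P_def by (intro countable_op_closure countable_image countable_SIGMA) auto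
  moreover have "P \<noteq> {}" using C_ne unfolding P_def by auto
  then have "Q \<noteq> {}" unfolding Q_def by (auto intro: op_closure.base)
  moreover have "0 \<le> q" if "q \<in> Q" for q
    using that unfolding Q_def
    by induction (auto simp: P_def crossing_nonneg le_supI1)
  ultimately obtain \<phi> :: "'a \<Rightarrow> real" where \<phi>: "bounded_linear \<phi>" "\<And>x. 0 \<le> x \<Longrightarrow> 0 \<le> \<phi> x"
      "\<And>q w. q \<in> Q \<Longrightarrow> 0 \<le> w \<Longrightarrow> \<phi> w = 0 \<Longrightarrow> norm q \<le> norm (q - w)"
    by (rule countable_strictly_positive_functional) (assumption, rule that, (assumption | simp)+)
  interpret \<phi>: bounded_linear \<phi> by fact
  have mono: "\<phi> x \<le> \<phi> z" if "x \<le> z" for x z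
    using \<phi>(2)[of "z - x"] that \<phi>.diff[of z x] by simp
  define g where "g j a = (1/2) ^ j * \<phi> (pprt (a - r j *\<^sub>R u))" for j a
  define H where "H a = (\<Sum>j. g j a)" for a
  have g0: "0 \<le> g j a" for j a using \<phi>(2) by (simp add: g_def)
  have summ: "summable (\<lambda>j. g j a)" if "a \<in> C 0" for a
  proof (rule summable_comparison_test')
    show "summable (\<lambda>j. (1/2::real) ^ j * \<phi> (2 *\<^sub>R u))" by (intro summable_mult2 summable_geometric) simp
    show "norm (g j a) \<le> (1/2) ^ j * \<phi> (2 *\<^sub>R u)" if "j \<ge> 0" for j
      using g0[of j a] mono[OF level[OF \<open>a \<in> C 0\<close>, of j]] by (simp add: g_def divide_right_mono mult_left_mono)
  qed
  have H0: "0 \<le> H a" if "a \<in> C 0" for a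
    unfolding H_def using g0 by (intro suminf_nonneg summ that)
  have defect: "(1/2) ^ j * \<phi> (crossing u (r j) a b) \<le> g j a + g j b - 2 * g j (midpoint a b)" for a b j
  proof -
    have "\<phi> (crossing u (r j) a b) \<le> \<phi> (pprt (a - r j *\<^sub>R u)) + \<phi> (pprt (b - r j *\<^sub>R u))
        - 2 * \<phi> (pprt (midpoint a b - r j *\<^sub>R u))"
      using mono[OF crossing_le_convexity_defect[of u "r j" a b]]
      by (simp add: midpoint_def \<phi>.add \<phi>.diff \<phi>.scaleR)
    then have "(1/2) ^ j * \<phi> (crossing u (r j) a b) \<le> (1/2) ^ j * (\<phi> (pprt (a - r j *\<^sub>R u)) + \<phi> (pprt (b - r j *\<^sub>R u))
        - 2 * \<phi> (pprt (midpoint a b - r j *\<^sub>R u)))"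
      by (rule mult_left_mono) simp
    then show ?thesis by (simp add: g_def algebra_simps)
  qed
  have H_defect: "(1/2) ^ j * \<phi> (crossing u (r j) a b) \<le> H a + H b - 2 * H (midpoint a b)"
    if "a \<in> C 0" "b \<in> C 0" for a b j
  proof -
    have "0 \<le> g j a + g j b - 2 * g j (midpoint a b)" for j
      using defect[of j a b] \<phi>(2)[OF crossing_nonneg, of u "r j" a b]
      by (meson mult_nonneg_nonneg order_trans zero_le_power zero_le_divide_1_iff zero_le_numeral)
    from midpoint_convex_series[of "C 0" g a b, OF summ _ _ C_mid this] that defect[of j a b]
    show ?thesis unfolding H_def by (meson order_trans)
  qed
  define m where "m k = (INF a\<in>C k. H a)" for k
  have C0: "a \<in> C 0" if "a \<in> C k" for a k using C_anti[of 0 k] that by auto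
  have bdd: "bdd_below (H ` C k)" for k
    by (rule bdd_belowI[of _ 0]) (use H0 C0 in auto)
  have m_le: "m k \<le> H a" if "a \<in> C k" for a k
    unfolding m_def by (rule cINF_lower[OF bdd that])
  have "\<exists>a\<in>C k. H a < m k + (1/2) ^ k" for k
  proof (rule ccontr)
    assume "\<not> ?thesis"
    then have "m k + (1/2) ^ k \<le> m k"
      unfolding m_def[of k] by (intro cINF_greatest C_ne) (auto simp: not_less m_def)
    with zero_less_power[of "1/2::real" k] show False by linarith
  qed
  then obtain z where z: "\<And>k. z k \<in> C k" "\<And>k. H (z k) < m k + (1/2) ^ k" by metis
  have "incseq m" unfolding m_def
    by (rule incseq_SucI, rule cINF_superset_mono) (use C_ne bdd C_anti in auto)
  moreover have "m k \<le> \<phi> (2 *\<^sub>R u) * 2" for k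
  proof -
    have "H (z k) \<le> (\<Sum>j. (1/2::real) ^ j * \<phi> (2 *\<^sub>R u))" unfolding H_def
      using mono[OF level[OF z(1)]]
      by (intro suminf_le summ C0[OF z(1)] summable_mult2 summable_geometric) (auto simp: g_def divide_right_mono)
    also have "\<dots> = \<phi> (2 *\<^sub>R u) * 2" by (subst suminf_mult2[symmetric]) (auto simp: suminf_geometric)
    finally show ?thesis using m_le[OF z(1), of k] by simp
  qed
  ultimately obtain mi where mi: "m \<longlonglongrightarrow> mi" "\<And>k. m k \<le> mi"
    using incseq_convergent[of m] by (metis (no_types, lifting))
  define \<epsilon> where "\<epsilon> k = 2 * (mi - m k) + 2 * (1/2) ^ k" for k
  have "\<epsilon> \<longlonglongrightarrow> 2 * (mi - mi) + 2 * 0" unfolding \<epsilon>_def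
    by (intro tendsto_intros mi LIMSEQ_power_zero) simp
  then have \<epsilon>: "\<epsilon> \<longlonglongrightarrow> 0" by simp
  have H_close: "H (z k) + H (z l) - 2 * H (midpoint (z k) (z l)) \<le> \<epsilon> n" if "n \<le> k" "n \<le> l" for k l n
  proof -
    have "z k \<in> C n" "z l \<in> C n" using z(1) C_anti that by blast+
    then have "m n \<le> H (midpoint (z k) (z l))" by (intro m_le C_mid)
    moreover have "H (z j) \<le> mi + (1/2) ^ n" if "n \<le> j" for j
    proof -
      have "(1/2::real) ^ j \<le> (1/2) ^ n" using that by (intro power_decreasing) auto
      with mi(2)[of j] have "m j + (1/2) ^ j \<le> mi + (1/2) ^ n" by (rule add_mono)
      with z(2)[of j] show ?thesis by (rule less_imp_le[OF less_le_trans])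
    qed
    from this[OF that(1)] this[OF that(2)]
    have "H (z k) + H (z l) \<le> (mi + (1/2) ^ n) + (mi + (1/2) ^ n)" by (rule add_mono)
    ultimately show ?thesis unfolding \<epsilon>_def by (simp add: algebra_simps)
  qed
  have small: "\<exists>N. \<forall>k\<ge>N. \<forall>l\<ge>N. norm (crossing u (r j) (z k) (z l)) < e" if e: "0 < e" for j e
  proof (rule ccontr)
    assume "\<not> ?thesis"
    then have bad: "\<exists>k l. N \<le> k \<and> N \<le> l \<and> e \<le> norm (crossing u (r j) (z k) (z l))" for N
      by (meson not_less)
    have "\<exists>N. \<epsilon> N < (1/2) ^ j * (1/2) ^ n" for n
      using order_tendstoD(2)[OF \<epsilon>, of "(1/2) ^ j * (1/2) ^ n"] eventually_happens'[OF sequentially_bot] by simp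
    then obtain N where N: "\<And>n. \<epsilon> (N n) < (1/2) ^ j * (1/2) ^ n" by metis
    obtain k l where kl: "\<And>n. N n \<le> k n" "\<And>n. N n \<le> l n"
        "\<And>n. e \<le> norm (crossing u (r j) (z (k n)) (z (l n)))"
      using bad[of "N _"] by metis
    define p where "p n = crossing u (r j) (z (k n)) (z (l n))" for n
    have "\<exists>n. norm (p n) < e"
    proof (rule strictly_positive_functional_controls_norm[OF mc \<phi>])
      show "sup a b \<in> Q" if "a \<in> Q" "b \<in> Q" for a b using that unfolding Q_def by (rule op_closure.op)
      fix n
      have zC: "z (k n) \<in> C 0" "z (l n) \<in> C 0" by (rule C0[OF z(1)])+
      then show "p n \<in> Q" unfolding Q_def P_def p_def
        by (intro op_closure.base image_eqI[of _ _ "(z (k n), z (l n), j)"]) auto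
      show "0 \<le> p n" unfolding p_def by (rule crossing_nonneg)
      show "p n \<le> 2 *\<^sub>R u" unfolding p_def crossing_def using level[OF zC(1)] by (rule le_infI1)
      have "(1/2) ^ j * \<phi> (p n) \<le> \<epsilon> (N n)"
        using H_defect[OF zC, of j] H_close[OF kl(1,2)] unfolding p_def by (meson order_trans)
      also have "\<dots> \<le> (1/2) ^ j * (1/2) ^ n" using N[of n] by simp
      finally show "\<phi> (p n) \<le> (1/2) ^ n" by simp
    qed (assumption | rule e)+
    then show False using kl(3) unfolding p_def by (meson not_less)
  qed
  have pprt_close: "\<exists>N. \<forall>k\<ge>N. \<forall>l\<ge>N. norm (pprt (z k - z l)) < e" if e: "0 < e" for e
  proof -
    \<comment> \<open>The grid of mesh \<open>h = 2 / M\<close> divides the range \<open>[-1, 1]\<close> of levels, and its levels are rational.\<close>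
    obtain M :: nat where M: "0 < M" "4 * norm u / e < real M"
      using reals_Archimedean2[of "max 0 (4 * norm u / e)"] by (metis max_less_iff_conj of_nat_0_less_iff)
    define h where "h = 2 / real M"
    have hu: "norm (h *\<^sub>R u) < e / 2" using M e by (simp add: h_def field_simps)
    have "\<exists>j. r j = real (Suc i) * h - 1" if "i < M" for i
    proof -
      have "real (Suc i) * h \<le> real M * h" using that M by (intro mult_right_mono) (auto simp: h_def)
      then have "real (Suc i) * h - 1 \<in> R" using M unfolding R_def h_def by auto
      then show ?thesis unfolding R_r by (metis imageE)
    qed
    then obtain j where j: "\<And>i. i < M \<Longrightarrow> r (j i) = real (Suc i) * h - 1" by metis
    have "\<forall>i. \<exists>N. \<forall>k\<ge>N. \<forall>l\<ge>N. norm (crossing u (r (j i)) (z k) (z l)) < e / (2 * real M)"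
      using small e M by simp
    then obtain N where N: "\<And>i k l. N i \<le> k \<Longrightarrow> N i \<le> l \<Longrightarrow>
        norm (crossing u (r (j i)) (z k) (z l)) < e / (2 * real M)" by metis
    have "norm (pprt (z k - z l)) < e" if kl: "Max (N ` {..<M}) \<le> k" "Max (N ` {..<M}) \<le> l" for k l
    proof -
      have NM: "N i \<le> Max (N ` {..<M})" if "i < M" for i using that by simp
      let ?S = "\<Sum>i<M. crossing u (real (Suc i) * h - 1) (z k) (z l)"
      have "norm (pprt (z k - z l)) \<le> norm (h *\<^sub>R u + ?S)"
        by (intro norm_mono_pos pprt_diff_le_sum_crossings[OF u C_u(2)[OF z(1)] C_u[OF z(1)] M(1) h_def]) simp
      also have "\<dots> \<le> norm (h *\<^sub>R u) + norm ?S" by (rule norm_triangle_ineq)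
      also have "norm ?S \<le> (\<Sum>i<M. e / (2 * real M))"
      proof (rule sum_norm_le)
        fix i assume "i \<in> {..<M}"
        then have i: "i < M" by simp
        show "norm (crossing u (real (Suc i) * h - 1) (z k) (z l)) \<le> e / (2 * real M)"
          using N[OF order_trans[OF NM[OF i] kl(1)] order_trans[OF NM[OF i] kl(2)]]
          unfolding j[OF i] by (rule less_imp_le)
      qed
      also have "\<dots> = e / 2" using M by simp
      finally show ?thesis using hu by simp
    qed
    then show ?thesis by blast
  qed
  have "Cauchy z"
  proof (rule metric_CauchyI)
    fix e :: real assume "0 < e"
    then obtain N where N: "\<And>k l. N \<le> k \<Longrightarrow> N \<le> l \<Longrightarrow> norm (pprt (z k - z l)) < e / 2"
      using pprt_close[of "e / 2"] by auto
    have "dist (z k) (z l) < e" if "N \<le> k" "N \<le> l" for k l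
    proof -
      have "z k - z l = pprt (z k - z l) - pprt (z l - z k)"
        using pprt_add_pprt_minus[of "z k - z l"] by (simp add: eq_diff_eq)
      then have "norm (z k - z l) \<le> norm (pprt (z k - z l)) + norm (pprt (z l - z k))"
        by (metis norm_triangle_ineq4)
      then show ?thesis using N[OF that] N[OF that(2,1)] by (simp add: dist_norm)
    qed
    then show "\<exists>M. \<forall>k\<ge>M. \<forall>l\<ge>M. dist (z k) (z l) < e" by blast
  qed
  then obtain v where v: "z \<longlonglongrightarrow> v" using Cauchy_convergent convergent_def by blast
  have "v \<in> closure (convex hull (y ` {k..}))" for k
  proof -
    have "z (n + k) \<in> convex hull (y ` {k..})" for n
      using z(1)[of "n + k"] C_anti[of k "n + k"] C_hull[of k] by auto
    moreover have "(\<lambda>n. z (n + k)) \<longlonglongrightarrow> v" using v by (rule LIMSEQ_ignore_initial_segment)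
    ultimately show ?thesis unfolding closure_sequential by (intro exI[of _ "\<lambda>n. z (n + k)"]) simp
  qed
  then show ?thesis unfolding tail_hull_point_def by blast
qed

section \<open>Operators with range in a principal ideal\<close>

text \<open>For real valued functions and \<open>z \<ge> 0\<close> the hypotheses say \<open>a \<ge> z\<close> and \<open>b \<ge> z\<close>
  at every point where \<open>z\<close> does not vanish.  In a lattice this becomes the statement that \<open>z\<close> is
  disjoint from the negative parts of \<open>a\<close> and \<open>b\<close>.\<close>

lemma le_pprt_convex_combination:
  fixes z a b :: "'a::banach_lattice"
  assumes z: "0 \<le> z" "z \<le> pprt a" "z \<le> pprt b" and st: "0 \<le> s" "0 \<le> t" "s + t = 1"
  shows "z \<le> pprt (s *\<^sub>R a + t *\<^sub>R b)"
proof -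
  have disjoint: "inf z (c *\<^sub>R pprt (- x)) = 0" if "z \<le> pprt x" "0 \<le> c" "c \<le> 1" for c x
  proof -
    have "c *\<^sub>R pprt (- x) \<le> 1 *\<^sub>R pprt (- x)" using that by (intro scaleR_right_mono) auto
    then have "inf z (c *\<^sub>R pprt (- x)) \<le> inf (pprt x) (pprt (- x))"
      using that by (intro inf_mono) auto
    moreover have "0 \<le> inf z (c *\<^sub>R pprt (- x))" using z that by (simp add: scaleR_nonneg_nonneg)
    ultimately show ?thesis by (simp add: pprt_disjoint antisym)
  qed
  define N where "N = s *\<^sub>R pprt (- a) + t *\<^sub>R pprt (- b)"
  have "inf z N = 0" unfolding N_def
    using z st by (intro disjoint_add disjoint scaleR_nonneg_nonneg) auto
  have "z - N = (s *\<^sub>R z + t *\<^sub>R z) - N" using st by (simp flip: scaleR_left_distrib)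
  also have "\<dots> \<le> (s *\<^sub>R pprt a + t *\<^sub>R pprt b) - N"
    using z st by (intro diff_right_mono add_mono scaleR_left_mono)
  also have "\<dots> = s *\<^sub>R (pprt a - pprt (- a)) + t *\<^sub>R (pprt b - pprt (- b))"
    by (simp add: N_def algebra_simps)
  also have "\<dots> = s *\<^sub>R a + t *\<^sub>R b"
    by (subst (1 3) pprt_add_pprt_minus) simp
  finally have "pprt (z - N) \<le> pprt (s *\<^sub>R a + t *\<^sub>R b)" by (rule pprt_mono)
  then show ?thesis using \<open>inf z N = 0\<close> by (simp add: pprt_diff_eq)
qed

text \<open>If \<open>pprt (T (x n) - T v)\<close> did not tend to \<open>0\<close>, then along a subsequence the elements
  \<open>pprt (T (x n) - T v - e u)\<close> would be bounded away from \<open>0\<close> in norm, and a further subsequence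
  would meet finitely: any finitely many of them lie above a common \<open>z > 0\<close>.  Such an inequality
  passes to convex combinations \<open>c\<close> of the terms.  But \<open>v\<close> is a limit of such \<open>c\<close>, and for
  \<open>c\<close> close to \<open>v\<close> the bound in the ideal norm gives \<open>T (c - v) \<le> e u\<close>.\<close>

lemma stable_point_pprt_tendsto:
  fixes T :: "'v::real_normed_vector \<Rightarrow> 'a::banach_lattice" and x :: "nat \<Rightarrow> 'v"
  assumes mc: "monotone_convergence_norm TYPE('a)"
    and T: "linear T" "\<And>y. \<bar>T y\<bar> \<le> (K * norm y) *\<^sub>R u" and K: "0 \<le> K" and u: "0 \<le> u"
    and bdd: "\<And>n. norm (x n) \<le> B"
    and v: "\<And>s :: nat \<Rightarrow> nat. strict_mono s \<Longrightarrow> tail_hull_point (x \<circ> s) v"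
  shows "(\<lambda>n. pprt (T (x n) - T v)) \<longlonglongrightarrow> 0"
proof (rule ccontr)
  assume not_tendsto: "\<not> (\<lambda>n. pprt (T (x n) - T v)) \<longlonglongrightarrow> 0"
  define g where "g n = T (x n) - T v" for n
  obtain d where d: "0 < d" "\<forall>N. \<exists>n\<ge>N. d \<le> norm (pprt (g n))"
    using not_tendsto unfolding LIMSEQ_iff g_def diff_0_right by (meson not_less)
  then have "infinite {n. d \<le> norm (pprt (g n))}"
    by (simp add: infinite_nat_iff_unbounded_le)
  from infinite_enumerate[OF this] obtain s :: "nat \<Rightarrow> nat" where s: "strict_mono s" "\<And>n. d \<le> norm (pprt (g (s n)))"
    by auto
  \<comment> \<open>with this \<open>e\<close>, subtracting \<open>e u\<close> costs at most half of \<open>d\<close>, also if \<open>u = 0\<close>\<close>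
  define e where "e = d / (2 * (norm u + 1))"
  have e: "0 < e" "e * norm u \<le> d / 2"
  proof -
    have u1: "0 < norm u + 1" using norm_ge_zero[of u] by linarith
    then show "0 < e" using d(1) by (simp add: e_def)
    have "e * norm u \<le> e * (norm u + 1)" using \<open>0 < e\<close> by (intro mult_left_mono) auto
    also have "\<dots> = d / 2" using u1 by (simp add: e_def field_simps)
    finally show "e * norm u \<le> d / 2" .
  qed
  define p where "p n = pprt (g (s n) - e *\<^sub>R u)" for n
  have g_le: "g n \<le> (K * (B + norm v)) *\<^sub>R u" for n
  proof -
    have "g n = T (x n - v)" unfolding g_def by (simp add: linear_diff[OF T(1)])
    also have "\<dots> \<le> (K * norm (x n - v)) *\<^sub>R u" by (rule abs_le_D1[OF T(2)])
    also have "\<dots> \<le> (K * (B + norm v)) *\<^sub>R u"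
      using norm_triangle_ineq4[of "x n" v] bdd[of n] K u by (intro scaleR_right_mono mult_left_mono) auto
    finally show ?thesis .
  qed
  have B: "0 \<le> B" using order_trans[OF norm_ge_zero bdd[of 0]] .
  obtain r :: "nat \<Rightarrow> nat" where r: "strict_mono r"
      "\<And>k. \<exists>z. 0 \<le> z \<and> z \<noteq> 0 \<and> (\<forall>i\<le>k. z \<le> p (r i))"
  proof (rule finitely_meeting_subsequence[OF mc, of p "(K * (B + norm v)) *\<^sub>R u" "d / 2"])
    fix n
    show "0 \<le> p n" by (simp add: p_def)
    have "0 \<le> (K * (B + norm v)) *\<^sub>R u" using B K u by (simp add: scaleR_nonneg_nonneg)
    moreover have "g (s n) - e *\<^sub>R u \<le> (K * (B + norm v)) *\<^sub>R u"
    proof -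
      have "g (s n) - e *\<^sub>R u \<le> g (s n)" using e(1) u by (simp add: diff_le_eq scaleR_nonneg_nonneg)
      then show ?thesis using g_le by (rule order_trans)
    qed
    ultimately show "p n \<le> (K * (B + norm v)) *\<^sub>R u" unfolding p_def pprt_def by (intro sup_least)
    have "pprt (g (s n)) \<le> p n + e *\<^sub>R u"
      using pprt_add_le[of "g (s n) - e *\<^sub>R u" "e *\<^sub>R u"] e(1) u by (simp add: p_def scaleR_nonneg_nonneg)
    then have "norm (pprt (g (s n))) \<le> norm (p n + e *\<^sub>R u)" by (intro norm_mono_pos) simp
    also have "\<dots> \<le> norm (p n) + e * norm u" using norm_triangle_ineq[of "p n" "e *\<^sub>R u"] e(1) by simp
    finally show "d / 2 \<le> norm (p n)" using s(2)[of n] e(2) by simp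
  next
    show "0 < d / 2" using d(1) by simp
  qed (rule that)
  define C where "C = convex hull ((x \<circ> (s \<circ> r)) ` {0..})"
  have vC: "v \<in> closure C"
    using v[OF strict_mono_o[OF s(1) r(1)]] unfolding tail_hull_point_def C_def by (rule spec)
  have "0 < e / (K + 1)" using e(1) K by simp
  from closure_approachableD[OF vC this] obtain c where c: "c \<in> C" "dist v c < e / (K + 1)" by blast
  define G where "G k c \<longleftrightarrow> (\<forall>z. 0 \<le> z \<longrightarrow> (\<forall>i\<le>k. z \<le> p (r i)) \<longrightarrow> z \<le> pprt (T (c - v) - e *\<^sub>R u))"
    for k c
  have GD: "z \<le> pprt (T (c - v) - e *\<^sub>R u)" if "G k c" "0 \<le> z" "\<And>i. i \<le> k \<Longrightarrow> z \<le> p (r i)" for k c z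
    using that by (simp add: G_def)
  define W where "W = {c. \<exists>k. G k c}"
  have "C \<subseteq> W"
    unfolding C_def
  proof (rule hull_minimal)
    show "(x \<circ> (s \<circ> r)) ` {0..} \<subseteq> W"
    proof
      fix c assume "c \<in> (x \<circ> (s \<circ> r)) ` {0..}"
      then obtain k where "c = x (s (r k))" by auto
      then have "G k c" by (simp add: G_def p_def g_def linear_diff[OF T(1)])
      then show "c \<in> W" unfolding W_def by blast
    qed
    show "convex W"
    proof (rule convexI)
      fix a b and \<alpha> \<beta> :: real assume ab: "a \<in> W" "b \<in> W" and \<alpha>\<beta>: "0 \<le> \<alpha>" "0 \<le> \<beta>" "\<alpha> + \<beta> = 1"
      obtain k where k: "G k a" using ab(1) unfolding W_def by blast
      obtain l where l: "G l b" using ab(2) unfolding W_def by blast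
      have "T ((\<alpha> *\<^sub>R a + \<beta> *\<^sub>R b) - v) - e *\<^sub>R u =
          (\<alpha> *\<^sub>R T a + \<beta> *\<^sub>R T b) - (\<alpha> + \<beta>) *\<^sub>R (T v + e *\<^sub>R u)"
        using \<alpha>\<beta>(3) by (simp add: linear_diff[OF T(1)] linear_add[OF T(1)] linear_scale[OF T(1)])
      also have "\<dots> = \<alpha> *\<^sub>R (T a - T v - e *\<^sub>R u) + \<beta> *\<^sub>R (T b - T v - e *\<^sub>R u)"
        by (simp only: diff_diff_eq scaleR_diff_right scaleR_left_distrib add_diff_add)
      finally have eq: "T ((\<alpha> *\<^sub>R a + \<beta> *\<^sub>R b) - v) - e *\<^sub>R u =
          \<alpha> *\<^sub>R (T (a - v) - e *\<^sub>R u) + \<beta> *\<^sub>R (T (b - v) - e *\<^sub>R u)"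
        by (simp only: linear_diff[OF T(1)])
      have "G (max k l) (\<alpha> *\<^sub>R a + \<beta> *\<^sub>R b)"
        unfolding G_def eq
        by (intro allI impI le_pprt_convex_combination GD[OF k] GD[OF l] \<alpha>\<beta>) simp_all
      then show "\<alpha> *\<^sub>R a + \<beta> *\<^sub>R b \<in> W" unfolding W_def by blast
    qed
  qed
  with c(1) obtain k where k: "G k c" unfolding W_def by blast
  obtain z where z: "0 \<le> z" "z \<noteq> 0" "\<And>i. i \<le> k \<Longrightarrow> z \<le> p (r i)" using r(2)[of k] by auto
  have "T (c - v) \<le> (K * norm (c - v)) *\<^sub>R u" by (rule abs_le_D1[OF T(2)])
  also have "\<dots> \<le> e *\<^sub>R u"
  proof (rule scaleR_right_mono[OF _ u])
    have "K * norm (c - v) \<le> (K + 1) * norm (c - v)" by (intro mult_right_mono) auto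
    also have "\<dots> \<le> e" using c(2) K by (simp add: dist_norm norm_minus_commute field_simps)
    finally show "K * norm (c - v) \<le> e" .
  qed
  finally have zero: "pprt (T (c - v) - e *\<^sub>R u) = 0" by simp
  have "z \<le> pprt (T (c - v) - e *\<^sub>R u)" by (rule GD[OF k z(1)]) (rule z(3))
  then have "z \<le> 0" unfolding zero .
  from antisym[OF this z(1)] z(2) show False by contradiction
qed

text \<open>Since \<open>T\<close> and \<open>- T\<close> satisfy the same hypotheses, the positive and negative parts of
  \<open>T (x n) - T v\<close> tend to \<open>0\<close> along a stable subsequence.\<close>

lemma convergent_image_subsequence:
  fixes T :: "'v::real_normed_vector \<Rightarrow> 'a::banach_lattice" and x :: "nat \<Rightarrow> 'v"
  assumes mc: "monotone_convergence_norm TYPE('a)"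
    and T: "linear T" "\<And>y. \<bar>T y\<bar> \<le> (K * norm y) *\<^sub>R u" and K: "0 \<le> K" and u: "0 \<le> u"
    and bdd: "\<And>n. norm (x n) \<le> B"
    and ex: "\<And>s :: nat \<Rightarrow> nat. strict_mono s \<Longrightarrow> \<exists>v. tail_hull_point (x \<circ> s) v"
  shows "\<exists>r. strict_mono (r :: nat \<Rightarrow> nat) \<and> convergent (\<lambda>n. T (x (r n)))"
proof -
  obtain r v where r: "strict_mono (r :: nat \<Rightarrow> nat)"
    "\<And>s :: nat \<Rightarrow> nat. strict_mono s \<Longrightarrow> tail_hull_point (x \<circ> r \<circ> s) v"
    by (rule stable_subsequence[of x B], rule bdd, erule ex, rule that, assumption, blast)
  have "(\<lambda>n. pprt (T ((x \<circ> r) n) - T v)) \<longlonglongrightarrow> 0"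
    by (rule stable_point_pprt_tendsto[OF mc T K u _ r(2)]) (use bdd in auto)
  moreover have "(\<lambda>n. pprt (- T ((x \<circ> r) n) - - T v)) \<longlonglongrightarrow> 0"
    by (rule stable_point_pprt_tendsto[OF mc linear_compose_neg[OF T(1)] _ K u _ r(2)]) (use T(2) bdd in auto)
  ultimately have "(\<lambda>n. pprt (T (x (r n)) - T v) - pprt (- (T (x (r n)) - T v))) \<longlonglongrightarrow> 0 - 0"
    by (intro tendsto_diff) simp_all
  moreover have "pprt y - pprt (- y) = y" for y :: 'a
    using pprt_add_pprt_minus[of y] by (simp add: diff_eq_eq)
  ultimately have "(\<lambda>n. T (x (r n)) - T v) \<longlonglongrightarrow> 0" by (simp only: diff_0_right)
  then have "(\<lambda>n. T (x (r n))) \<longlonglongrightarrow> T v" by (rule LIM_zero_cancel)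
  with r(1) show ?thesis unfolding convergent_def by blast
qed

text \<open>Boundedness of \<open>T\<close> into the principal ideal with its order unit norm.  The domain is the
  union of the closed sets where \<open>\<bar>T x\<bar> \<le> n u\<close>, and by the Baire category theorem one of them
  contains a ball.\<close>

lemma principal_ideal_range_bound:
  fixes T :: "'v::banach \<Rightarrow> 'a::banach_lattice"
  assumes T: "bounded_linear T" "range T \<subseteq> principal_ideal u" and u: "0 \<le> u"
  obtains K where "0 \<le> K" "\<And>x. \<bar>T x\<bar> \<le> (K * norm x) *\<^sub>R u"
proof -
  interpret bounded_linear T by fact
  define F where "F n = {x. \<bar>T x\<bar> \<le> real n *\<^sub>R u}" for n
  have "closed (F n)" for n
  proof -
    have "F n = T -` {y. y \<le> real n *\<^sub>R u} \<inter> T -` {y. - (real n *\<^sub>R u) \<le> y}"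
      unfolding F_def by (auto simp: abs_le_iff minus_le_iff)
    then show ?thesis
      by (auto simp del: vimage_Collect_eq intro!: closed_Int continuous_closed_vimage closed_atMost_lattice
          closed_atLeast_lattice linear_continuous_at T)
  qed
  moreover have "(\<Union>n. F n) = UNIV"
  proof (intro set_eqI iffI UNIV_I)
    fix x
    obtain c where c: "0 \<le> c" "\<bar>T x\<bar> \<le> c *\<^sub>R u" using T(2) unfolding principal_ideal_def by blast
    have "c *\<^sub>R u \<le> real (nat \<lceil>c\<rceil>) *\<^sub>R u" using u by (intro scaleR_right_mono) linarith+
    with c(2) show "x \<in> (\<Union>n. F n)" unfolding F_def by (blast intro: order_trans)
  qed
  moreover have "completely_metrizable_space (euclidean :: 'v topology)"
    by (rule completely_metrizable_space_euclidean)
  ultimately have "\<exists>n. interior (F n) \<noteq> {}"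
    using Baire_category_alt[of "euclidean :: 'v topology" "range F"] by auto
  then obtain n x0 where "x0 \<in> interior (F n)" by blast
  then obtain e where e: "0 < e" "ball x0 e \<subseteq> F n" unfolding mem_interior by blast
  have small: "T x \<le> (2 * real n) *\<^sub>R u" if "norm x < e" for x
  proof -
    have "T (x0 + x) \<le> real n *\<^sub>R u" "- T x0 \<le> real n *\<^sub>R u"
      using e that by (auto simp: F_def dist_norm abs_le_iff subset_iff)
    from add_mono[OF this] show ?thesis by (simp add: add scaleR_2 flip: scaleR_scaleR)
  qed
  define K where "K = (2 / e) * (2 * real n)"
  have le: "T x \<le> (K * norm x) *\<^sub>R u" for x
  proof (cases "x = 0")
    case False
    have "T ((e / (2 * norm x)) *\<^sub>R x) \<le> (2 * real n) *\<^sub>R u" using False e(1) by (intro small) simp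
    then have "(2 * norm x / e) *\<^sub>R ((e / (2 * norm x)) *\<^sub>R T x) \<le> (2 * norm x / e) *\<^sub>R ((2 * real n) *\<^sub>R u)"
      using e(1) by (intro scaleR_left_mono) (auto simp: scale)
    then show ?thesis using False e(1) by (simp add: K_def field_simps)
  qed (simp add: zero)
  have "\<bar>T x\<bar> \<le> (K * norm x) *\<^sub>R u" for x
    using le[of x] le[of "- x"] by (simp add: abs_le_iff neg)
  moreover have "0 \<le> K" using e(1) by (simp add: K_def)
  ultimately show ?thesis using that by blast
qed

section \<open>Compactness through subsequences\<close>

definition subseq_compact_map :: "('v::real_normed_vector \<Rightarrow> 'w::real_normed_vector) \<Rightarrow> bool" where
  "subseq_compact_map f \<longleftrightarrow> (\<forall>x :: nat \<Rightarrow> 'v. (\<forall>n. norm (x n) \<le> 1) \<longrightarrow>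
     (\<exists>r. strict_mono (r :: nat \<Rightarrow> nat) \<and> convergent (\<lambda>n. f (x (r n)))))"

lemma subseq_compact_mapE:
  assumes "subseq_compact_map f" "\<And>n. norm (x n) \<le> 1"
  obtains r l where "strict_mono (r :: nat \<Rightarrow> nat)" "(\<lambda>n. f (x (r n))) \<longlonglongrightarrow> l"
proof -
  have "\<exists>r. strict_mono (r :: nat \<Rightarrow> nat) \<and> convergent (\<lambda>n. f (x (r n)))"
    using assms(1)[unfolded subseq_compact_map_def, rule_format, of x] assms(2) by simp
  then show ?thesis using that unfolding convergent_def by (elim exE conjE)
qed

lemma subseq_compact_map_imp_compact:
  assumes f: "subseq_compact_map f"
  shows "compact (closure (f ` cball 0 1))"
  unfolding compact_eq_seq_compact_metric
proof (rule seq_compactI)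
  fix c :: "nat \<Rightarrow> _" assume c: "\<forall>n. c n \<in> closure (f ` cball 0 1)"
  have "\<exists>x. norm x \<le> 1 \<and> dist (f x) (c n) < 1 / real (Suc n)" for n
  proof -
    have "0 < 1 / real (Suc n)" by simp
    then obtain y where "y \<in> f ` cball 0 1" "dist y (c n) < 1 / real (Suc n)"
      using c[rule_format, of n, unfolded closure_approachable, rule_format] by meson
    then show ?thesis by auto
  qed
  then obtain x where x: "\<And>n. norm (x n) \<le> 1" "\<And>n. dist (f (x n)) (c n) < 1 / real (Suc n)" by metis
  obtain r l where r: "strict_mono (r :: nat \<Rightarrow> nat)" "(\<lambda>n. f (x (r n))) \<longlonglongrightarrow> l"
    by (rule subseq_compact_mapE[OF f x(1)])
  have "(\<lambda>n. f (x n) - c n) \<longlonglongrightarrow> 0"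
    by (rule Lim_null_comparison[OF _ LIMSEQ_Suc[OF lim_1_over_n]])
      (use x(2) in \<open>auto simp: dist_norm intro!: always_eventually less_imp_le\<close>)
  from LIMSEQ_subseq_LIMSEQ[OF this r(1)] have "(\<lambda>n. f (x (r n)) - c (r n)) \<longlonglongrightarrow> 0" by (simp add: o_def)
  from tendsto_diff[OF r(2) this] have lim: "(c \<circ> r) \<longlonglongrightarrow> l" by (simp add: o_def)
  have "l \<in> closure (f ` cball 0 1)"
    using closed_sequentially[OF closed_closure _ lim] c by (auto simp: o_def)
  with r(1) lim show "\<exists>l\<in>closure (f ` cball 0 1). \<exists>r. strict_mono r \<and> (c \<circ> r) \<longlonglongrightarrow> l"
    by (intro bexI[of _ l] exI[of _ r] conjI)
qed

lemma subseq_compact_map_combine: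
  assumes f: "subseq_compact_map f" and g: "subseq_compact_map g"
    and h: "\<And>a b l m. a \<longlonglongrightarrow> l \<Longrightarrow> b \<longlonglongrightarrow> m \<Longrightarrow> (\<lambda>n. h (a n) (b n)) \<longlonglongrightarrow> h l m"
  shows "subseq_compact_map (\<lambda>z. h (f z) (g z))"
  unfolding subseq_compact_map_def
proof (intro allI impI)
  fix x :: "nat \<Rightarrow> 'a" assume x: "\<forall>n. norm (x n) \<le> 1"
  obtain r l where r: "strict_mono (r :: nat \<Rightarrow> nat)" "(\<lambda>n. f (x (r n))) \<longlonglongrightarrow> l"
    by (rule subseq_compact_mapE[OF f x[rule_format]])
  obtain s m where s: "strict_mono (s :: nat \<Rightarrow> nat)" "(\<lambda>n. g ((x \<circ> r) (s n))) \<longlonglongrightarrow> m"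
    by (rule subseq_compact_mapE[OF g, of "x \<circ> r"]) (use x in auto)
  have "(\<lambda>n. h (f (x (r (s n)))) (g (x (r (s n))))) \<longlonglongrightarrow> h l m"
    using h LIMSEQ_subseq_LIMSEQ[OF r(2) s(1)] s(2) by (simp add: o_def)
  then show "\<exists>r. strict_mono r \<and> convergent (\<lambda>n. h (f (x (r n))) (g (x (r n))))"
    using strict_mono_o[OF r(1) s(1)] by (intro exI[of _ "r \<circ> s"] conjI) (auto intro: convergentI)
qed

lemma subseq_compact_map_compose:
  fixes f :: "'v::real_normed_vector \<Rightarrow> 'w::real_normed_vector"
    and q :: "'u::real_normed_vector \<Rightarrow> 'v"
  assumes "subseq_compact_map f" "\<And>z. norm (q z) \<le> norm z"
  shows "subseq_compact_map (\<lambda>z. f (q z))"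
  unfolding subseq_compact_map_def
proof (intro allI impI)
  fix x :: "nat \<Rightarrow> 'u" assume "\<forall>n. norm (x n) \<le> 1"
  then have q: "norm (q (x n)) \<le> 1" for n using order_trans[OF assms(2)] by blast
  obtain r l where "strict_mono (r :: nat \<Rightarrow> nat)" "(\<lambda>n. f (q (x (r n)))) \<longlonglongrightarrow> l"
    by (rule subseq_compact_mapE[OF assms(1) q])
  then show "\<exists>r. strict_mono (r :: nat \<Rightarrow> nat) \<and> convergent (\<lambda>n. f (q (x (r n))))"
    by (intro exI[of _ r] conjI) (auto intro: convergentI)
qed

text \<open>The inner operator maps the unit ball into an order interval, all of whose sequences have tail
  hull points; the outer one turns these into norm convergence.\<close>

lemma order_continuous_subseq_compact_compose:
  fixes A B :: "'a::banach_lattice \<Rightarrow> 'a"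
  assumes ocn: "order_continuous_norm TYPE('a)" and u: "0 \<le> u"
    and A: "bounded_linear A" "range A \<subseteq> principal_ideal u"
    and B: "bounded_linear B" "range B \<subseteq> principal_ideal u"
  shows "subseq_compact_map (\<lambda>x. A (B x))"
  unfolding subseq_compact_map_def
proof (intro allI impI)
  fix x :: "nat \<Rightarrow> 'a" assume x: "\<forall>n. norm (x n) \<le> 1"
  obtain K where K: "0 \<le> K" "\<And>y. \<bar>A y\<bar> \<le> (K * norm y) *\<^sub>R u"
    by (rule principal_ideal_range_bound[OF A u]) blast
  obtain L where L: "0 \<le> L" "\<And>y. \<bar>B y\<bar> \<le> (L * norm y) *\<^sub>R u"
    by (rule principal_ideal_range_bound[OF B u]) blast
  have bound: "\<bar>B (x n)\<bar> \<le> L *\<^sub>R u" for n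
  proof -
    have "(L * norm (x n)) *\<^sub>R u \<le> L *\<^sub>R u"
      using x L(1) u by (intro scaleR_right_mono) (auto intro: mult_left_le)
    with L(2)[of "x n"] show ?thesis by (rule order_trans)
  qed
  have mc: "monotone_convergence_norm TYPE('a)"
    by (rule order_continuous_norm_imp_monotone_convergence[OF ocn])
  show "\<exists>r. strict_mono (r :: nat \<Rightarrow> nat) \<and> convergent (\<lambda>n. A (B (x (r n))))"
  proof (rule convergent_image_subsequence[OF mc bounded_linear.linear[OF A(1)] K(2) K(1) u])
    show "norm (B (x n)) \<le> norm (L *\<^sub>R u)" for n
      by (rule norm_mono_abs, rule order_trans[OF bound abs_ge_self])
    fix s :: "nat \<Rightarrow> nat"
    show "\<exists>v. tail_hull_point ((\<lambda>n. B (x n)) \<circ> s) v"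
      by (rule order_bounded_imp_tail_hull_point[OF mc, of _ "L *\<^sub>R u"]) (simp add: bound)
  qed
qed

lemma reflexive_subseq_compact:
  fixes T :: "'a::banach_lattice \<Rightarrow> 'a"
  assumes refl: "reflexive_space (scaleR :: real \<Rightarrow> 'a \<Rightarrow> 'a)" and u: "0 \<le> u"
    and T: "bounded_linear T" "range T \<subseteq> principal_ideal u"
  shows "subseq_compact_map T"
  unfolding subseq_compact_map_def
proof (intro allI impI)
  fix x :: "nat \<Rightarrow> 'a" assume x: "\<forall>n. norm (x n) \<le> 1"
  obtain K where K: "0 \<le> K" "\<And>y. \<bar>T y\<bar> \<le> (K * norm y) *\<^sub>R u"
    by (rule principal_ideal_range_bound[OF T u]) blast
  show "\<exists>r. strict_mono (r :: nat \<Rightarrow> nat) \<and> convergent (\<lambda>n. T (x (r n)))"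
  proof (rule convergent_image_subsequence[OF reflexive_imp_monotone_convergence[OF refl]
        bounded_linear.linear[OF T(1)] K(2) K(1) u])
    show "norm (x n) \<le> 1" for n using x by blast
    show "\<exists>v. tail_hull_point (x \<circ> s) v" for s :: "nat \<Rightarrow> nat"
      by (rule reflexive_imp_tail_hull_point[OF refl, of _ 1]) (simp add: x)
  qed
qed

section \<open>Passage to the real part of a complex Banach lattice\<close>

lemma bounded_linear_re_part: "bounded_linear (re_part :: 'a::banach_lattice complexification \<Rightarrow> 'a)"
  and bounded_linear_im_part: "bounded_linear (im_part :: 'a complexification \<Rightarrow> 'a)"
  by (rule bounded_linear_intro[where K = 1]; simp add: norm_re_part_le norm_im_part_le)+

lemma bounded_linear_Complexify_real:
  "bounded_linear (\<lambda>x :: 'a::banach_lattice. Complexify x 0)"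
proof (rule bounded_linear_intro[where K = 1])
  show "norm (Complexify x 0) \<le> norm x * 1" for x :: 'a
    using norm_complexification_le[of "Complexify x 0"] by simp
qed (simp_all add: complexification_eq_iff)

lemma tendsto_Complexify:
  fixes a b :: "nat \<Rightarrow> 'a::banach_lattice"
  assumes "a \<longlonglongrightarrow> l" "b \<longlonglongrightarrow> m"
  shows "(\<lambda>n. Complexify (a n) (b n)) \<longlonglongrightarrow> Complexify l m"
proof -
  have "(\<lambda>n. norm (a n - l) + norm (b n - m)) \<longlonglongrightarrow> 0"
    using assms by (auto intro!: tendsto_add_zero tendsto_norm_zero LIM_zero)
  then have "(\<lambda>n. Complexify (a n) (b n) - Complexify l m) \<longlonglongrightarrow> 0"
    by (rule Lim_null_comparison[rotated])
      (use norm_complexification_le[of "Complexify (a _) (b _) - Complexify l m"] in auto)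
  then show ?thesis by (rule LIM_zero_cancel)
qed

text \<open>A complex functional \<open>F\<close> restricts on the real part to \<open>re F + \<i> im F\<close> with real functionals
  \<open>re F\<close> and \<open>im F\<close>, so a real bidual functional \<open>\<phi>\<close> extends to the complex bidual functional
  \<open>F \<mapsto> \<phi> (re F) + \<i> \<phi> (im F)\<close>.  If \<open>w\<close> represents the extension, testing with the complex
  extension of a real functional \<open>f\<close> shows that \<open>re_part w\<close> represents \<open>\<phi>\<close>.\<close>

lemma reflexive_space_scaleC_imp_scaleR:
  assumes refl: "reflexive_space (scaleC :: complex \<Rightarrow> 'a complexification \<Rightarrow> 'a::banach_lattice complexification)"
  shows "reflexive_space (scaleR :: real \<Rightarrow> 'a \<Rightarrow> 'a)"
  unfolding reflexive_space_def
proof (intro allI impI)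
  fix \<phi> :: "('a \<Rightarrow> real) \<Rightarrow> real"
  assume bi: "bidual_functional scaleR \<phi>"
  have \<phi>_add: "\<phi> (\<lambda>v. f v + g v) = \<phi> f + \<phi> g" if "bounded_linear f" "bounded_linear g" for f g
    using bi that unfolding bidual_functional_def dual_space_scaleR by blast
  have \<phi>_mult: "\<phi> (\<lambda>v. c * f v) = c * \<phi> f" if "bounded_linear f" for c f
    using bi that unfolding bidual_functional_def dual_space_scaleR by blast
  obtain K where K0: "\<And>f. bounded_linear f \<Longrightarrow> norm (\<phi> f) \<le> K * onorm f"
    using bi unfolding bidual_functional_def dual_space_scaleR by auto
  have K: "\<bar>\<phi> f\<bar> \<le> \<bar>K\<bar> * onorm f" if f: "bounded_linear f" for f
  proof -
    have "\<bar>\<phi> f\<bar> \<le> K * onorm f" using K0[OF f] by simp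
    also have "\<dots> \<le> \<bar>K\<bar> * onorm f" by (intro mult_right_mono onorm_pos_le f) simp
    finally show ?thesis .
  qed
  define re where "re F = (\<lambda>x :: 'a. Re (F (Complexify x 0)))" for F :: "'a complexification \<Rightarrow> complex"
  define im where "im F = (\<lambda>x :: 'a. Im (F (Complexify x 0)))" for F :: "'a complexification \<Rightarrow> complex"
  have dual: "bounded_linear F" "F (scaleC c z) = c * F z" if "F \<in> dual_space scaleC"
    for F :: "'a complexification \<Rightarrow> complex" and c z
    using that by (auto simp: dual_space_def)
  have bl: "bounded_linear (re F)" "bounded_linear (im F)" if "bounded_linear F" for F
    unfolding re_def im_def
    using that bounded_linear_Complexify_real bounded_linear_Re bounded_linear_Im
    by (auto intro: bounded_linear_compose)
  have on: "onorm (re F) \<le> onorm F" "onorm (im F) \<le> onorm F" if F: "bounded_linear F" for F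
  proof -
    have "cmod (F (Complexify x 0)) \<le> onorm F * norm x" for x
    proof -
      have "cmod (F (Complexify x 0)) \<le> onorm F * norm (Complexify x 0)" by (rule onorm[OF F])
      also have "\<dots> \<le> onorm F * norm x"
        using norm_complexification_le[of "Complexify x 0"] by (intro mult_left_mono onorm_pos_le F) simp
      finally show ?thesis .
    qed
    then have "norm (re F x) \<le> onorm F * norm x" "norm (im F x) \<le> onorm F * norm x" for x
      unfolding re_def im_def real_norm_def
      using abs_Re_le_cmod abs_Im_le_cmod order_trans by blast+
    then show "onorm (re F) \<le> onorm F" "onorm (im F) \<le> onorm F"
      using onorm_bound[OF onorm_pos_le[OF F], of "re F"] onorm_bound[OF onorm_pos_le[OF F], of "im F"] by blast+
  qed
  define \<Phi> where "\<Phi> F = Complex (\<phi> (re F)) (\<phi> (im F))" for F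
  have "bidual_functional scaleC \<Phi>"
    unfolding bidual_functional_def
  proof (intro conjI ballI allI exI[of _ "2 * \<bar>K\<bar>"])
    fix F G :: "'a complexification \<Rightarrow> complex" and c :: complex
    assume F: "F \<in> dual_space scaleC"
    note F' = bl[OF dual(1)[OF F]]
    have "re (\<lambda>v. c * F v) = (\<lambda>x. Re c * re F x + (- Im c) * im F x)"
      "im (\<lambda>v. c * F v) = (\<lambda>x. Re c * im F x + Im c * re F x)"
      by (auto simp: re_def im_def algebra_simps)
    moreover have "\<phi> (\<lambda>x. Re c * re F x + (- Im c) * im F x) = Re c * \<phi> (re F) + (- Im c) * \<phi> (im F)"
      using F' by (subst \<phi>_add) (auto simp only: \<phi>_mult intro!: bounded_linear_const_mult)
    moreover have "\<phi> (\<lambda>x. Re c * im F x + Im c * re F x) = Re c * \<phi> (im F) + Im c * \<phi> (re F)"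
      using F' by (subst \<phi>_add) (auto simp only: \<phi>_mult intro!: bounded_linear_const_mult)
    ultimately show "\<Phi> (\<lambda>v. c * F v) = c * \<Phi> F"
      by (simp add: \<Phi>_def complex_eq_iff)
    have "norm (\<Phi> F) \<le> \<bar>\<phi> (re F)\<bar> + \<bar>\<phi> (im F)\<bar>"
      using cmod_le[of "\<Phi> F"] by (simp add: \<Phi>_def)
    also have "\<dots> \<le> \<bar>K\<bar> * onorm F + \<bar>K\<bar> * onorm F"
      using K[OF F'(1)] K[OF F'(2)] mult_left_mono[OF on(1)[OF dual(1)[OF F]], of "\<bar>K\<bar>"]
        mult_left_mono[OF on(2)[OF dual(1)[OF F]], of "\<bar>K\<bar>"] by linarith
    finally show "norm (\<Phi> F) \<le> 2 * \<bar>K\<bar> * onorm F" by simp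
    assume G: "G \<in> dual_space scaleC"
    have "re (\<lambda>v. F v + G v) = (\<lambda>x. re F x + re G x)" "im (\<lambda>v. F v + G v) = (\<lambda>x. im F x + im G x)"
      by (auto simp: re_def im_def)
    then show "\<Phi> (\<lambda>v. F v + G v) = \<Phi> F + \<Phi> G"
      using F' bl[OF dual(1)[OF G]] by (simp add: \<Phi>_def \<phi>_add complex_eq_iff)
  qed
  with refl have "\<exists>w. \<forall>F\<in>dual_space scaleC. \<Phi> F = F w"
    unfolding reflexive_space_def by (elim allE[of _ \<Phi>]) (rule mp)
  then obtain w where w: "\<And>F. F \<in> dual_space scaleC \<Longrightarrow> \<Phi> F = F w" by blast
  have "\<phi> f = f (re_part w)" if f: "bounded_linear f" for f
  proof -
    interpret f: bounded_linear f by (rule f)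
    define F where "F z = Complex (f (re_part z)) (f (im_part z))" for z
    have "bounded_linear F"
    proof (rule bounded_linear_intro[where K = "onorm f + onorm f"])
      fix z
      have "norm (F z) \<le> \<bar>f (re_part z)\<bar> + \<bar>f (im_part z)\<bar>" using cmod_le[of "F z"] by (simp add: F_def)
      also have "\<dots> \<le> onorm f * norm z + onorm f * norm z"
      proof (intro add_mono)
        show "\<bar>f (re_part z)\<bar> \<le> onorm f * norm z"
          using onorm[OF f, of "re_part z"] mult_left_mono[OF norm_re_part_le[of z] onorm_pos_le[OF f]] by simp
        show "\<bar>f (im_part z)\<bar> \<le> onorm f * norm z"
          using onorm[OF f, of "im_part z"] mult_left_mono[OF norm_im_part_le[of z] onorm_pos_le[OF f]] by simp
      qed
      finally show "norm (F z) \<le> norm z * (onorm f + onorm f)" by (simp add: algebra_simps)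
    qed (auto simp: F_def complex_eq_iff f.add f.scaleR)
    then have "F \<in> dual_space scaleC"
      by (auto simp: dual_space_def F_def complex_eq_iff scaleC_def f.add f.diff f.scaleR)
    from arg_cong[OF w[OF this], of Re] show ?thesis
      by (simp add: \<Phi>_def re_def F_def)
  qed
  then show "\<exists>v. \<forall>f\<in>dual_space scaleR. \<phi> f = f v" unfolding dual_space_scaleR by blast
qed

text \<open>Here \<open>A\<close> and \<open>B\<close> are the real and imaginary parts of the restriction of \<open>S\<close> to the real
  part of the lattice.\<close>

lemma complex_operator_decomposition:
  fixes S :: "'a::banach_lattice complexification \<Rightarrow> 'a complexification"
  assumes S: "S \<in> bounded_operators scaleC" "range S \<subseteq> principal_ideal v"
  obtains A B :: "'a \<Rightarrow> 'a" where
    "bounded_linear A" "range A \<subseteq> principal_ideal (re_part v)"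
    "bounded_linear B" "range B \<subseteq> principal_ideal (re_part v)"
    "\<And>z. S z = Complexify (A (re_part z) - B (im_part z)) (B (re_part z) + A (im_part z))"
proof -
  define A where "A x = re_part (S (Complexify x 0))" for x
  define B where "B x = im_part (S (Complexify x 0))" for x
  have bl: "bounded_linear S" and homogeneous: "\<And>c z. S (scaleC c z) = scaleC c (S z)"
    using S(1) by (auto simp: bounded_operators_def)
  interpret bounded_linear S by (rule bl)
  have comp: "bounded_linear (\<lambda>x. S (Complexify x 0))"
    by (rule bounded_linear_compose[OF bl bounded_linear_Complexify_real])
  have "bounded_linear A" "bounded_linear B" unfolding A_def B_def
    by (rule bounded_linear_compose[OF bounded_linear_re_part comp],
        rule bounded_linear_compose[OF bounded_linear_im_part comp])
  moreover have "A x \<in> principal_ideal (re_part v) \<and> B x \<in> principal_ideal (re_part v)" for x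
  proof -
    obtain c where "0 \<le> c" "\<bar>S (Complexify x 0)\<bar> \<le> c *\<^sub>R v"
      using S(2) unfolding principal_ideal_def by blast
    then have c: "0 \<le> c" "modulus (S (Complexify x 0)) \<le> c *\<^sub>R re_part v"
      by (simp_all add: abs_complexification_def less_eq_complexification_def)
    show ?thesis unfolding principal_ideal_def A_def B_def
      using c order_trans[OF modulus_ge_re c(2)] order_trans[OF modulus_ge_im c(2)] by auto
  qed
  then have "range A \<subseteq> principal_ideal (re_part v)" "range B \<subseteq> principal_ideal (re_part v)" by auto
  moreover have "S z = Complexify (A (re_part z) - B (im_part z)) (B (re_part z) + A (im_part z))" for z
  proof -
    have "z = Complexify (re_part z) 0 + scaleC \<i> (Complexify (im_part z) 0)"
      by (simp add: complexification_eq_iff scaleC_def)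
    then have "S z = S (Complexify (re_part z) 0 + scaleC \<i> (Complexify (im_part z) 0))"
      by (rule arg_cong)
    also have "\<dots> = S (Complexify (re_part z) 0) + scaleC \<i> (S (Complexify (im_part z) 0))"
      by (simp only: add homogeneous)
    finally have "S z = \<dots>" .
    then show ?thesis by (simp add: complexification_eq_iff scaleC_def A_def B_def)
  qed
  ultimately show ?thesis using that by blast
qed

lemma subseq_compact_map_add:
  "subseq_compact_map f \<Longrightarrow> subseq_compact_map g \<Longrightarrow> subseq_compact_map (\<lambda>z. f z + g z)"
  by (rule subseq_compact_map_combine[where h = "(+)"]) (auto intro: tendsto_add)

lemma subseq_compact_map_diff:
  "subseq_compact_map f \<Longrightarrow> subseq_compact_map g \<Longrightarrow> subseq_compact_map (\<lambda>z. f z - g z)"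
  by (rule subseq_compact_map_combine[where h = "(-)"]) (auto intro: tendsto_diff)

lemma subseq_compact_map_Complexify:
  "subseq_compact_map f \<Longrightarrow> subseq_compact_map g \<Longrightarrow> subseq_compact_map (\<lambda>z. Complexify (f z) (g z))"
  by (rule subseq_compact_map_combine[where h = Complexify]) (auto intro: tendsto_Complexify)

lemma bounded_operators_compose:
  "T \<in> bounded_operators smul \<Longrightarrow> T \<circ> T \<in> bounded_operators smul"
  unfolding bounded_operators_def by (auto simp: o_def intro: bounded_linear_compose)

section \<open>Compactness of operators with range in a principal ideal\<close>

text \<open>In the complex case \<open>S\<close> and \<open>S \<circ> S\<close> are assembled from the real operators \<open>A\<close>, \<open>B\<close> and
  from their products of length two, respectively.\<close>

theorem theorem2p3:
  fixes u :: "'a::banach_lattice" and T :: "'a \<Rightarrow> 'a"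
    and v :: "'b::banach_lattice complexification"
    and S :: "'b complexification \<Rightarrow> 'b complexification"
  shows
    "(0 \<le> u \<and> T \<in> bounded_operators scaleR \<and> range T \<subseteq> principal_ideal u \<longrightarrow>
        (order_continuous_norm TYPE('a) \<longrightarrow> compact_operator scaleR (T \<circ> T)) \<and>
        (reflexive_space (scaleR :: real \<Rightarrow> 'a \<Rightarrow> 'a) \<longrightarrow> compact_operator scaleR T)) \<and>
     (0 \<le> v \<and> S \<in> bounded_operators scaleC \<and> range S \<subseteq> principal_ideal v \<longrightarrow>
        (order_continuous_norm TYPE('b) \<longrightarrow> compact_operator scaleC (S \<circ> S)) \<and>
        (reflexive_space (scaleC :: complex \<Rightarrow> 'b complexification \<Rightarrow> 'b complexification) \<longrightarrow>
           compact_operator scaleC S))"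
proof (intro conjI impI; elim conjE)
  assume u: "0 \<le> u" and T: "T \<in> bounded_operators scaleR" "range T \<subseteq> principal_ideal u"
  have bl: "bounded_linear T" using T(1) by (simp add: bounded_operators_def)
  show "compact_operator scaleR (T \<circ> T)" if ocn: "order_continuous_norm TYPE('a)"
    using subseq_compact_map_imp_compact[OF order_continuous_subseq_compact_compose[OF ocn u bl T(2) bl T(2)]]
      bounded_operators_compose[OF T(1)]
    by (simp add: compact_operator_def o_def)
  show "compact_operator scaleR T" if refl: "reflexive_space (scaleR :: real \<Rightarrow> 'a \<Rightarrow> 'a)"
    using subseq_compact_map_imp_compact[OF reflexive_subseq_compact[OF refl u bl T(2)]] T(1)
    by (simp add: compact_operator_def)
next
  assume v: "0 \<le> v" and S: "S \<in> bounded_operators scaleC" "range S \<subseteq> principal_ideal v"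
  have u: "0 \<le> re_part v" using v by (simp add: less_eq_complexification_def)
  obtain A B :: "'b \<Rightarrow> 'b" where A: "bounded_linear A" "range A \<subseteq> principal_ideal (re_part v)"
    and B: "bounded_linear B" "range B \<subseteq> principal_ideal (re_part v)"
    and S_eq: "\<And>z. S z = Complexify (A (re_part z) - B (im_part z)) (B (re_part z) + A (im_part z))"
    by (rule complex_operator_decomposition[OF S]) blast
  note parts = subseq_compact_map_compose[OF _ norm_re_part_le] subseq_compact_map_compose[OF _ norm_im_part_le]
  note combine = subseq_compact_map_Complexify subseq_compact_map_add subseq_compact_map_diff
  show "compact_operator scaleC (S \<circ> S)" if ocn: "order_continuous_norm TYPE('b)"
  proof -
    note c = order_continuous_subseq_compact_compose[OF ocn u]
    have "S \<circ> S = (\<lambda>z. Complexify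
        ((A (A (re_part z)) - A (B (im_part z))) - (B (B (re_part z)) + B (A (im_part z))))
        ((B (A (re_part z)) - B (B (im_part z))) + (A (B (re_part z)) + A (A (im_part z)))))"
      by (auto simp: S_eq linear_simps[OF A(1)] linear_simps[OF B(1)])
    moreover have "subseq_compact_map \<dots>"
      by (intro combine parts c A B)
    ultimately show ?thesis
      using subseq_compact_map_imp_compact[of "S \<circ> S"] bounded_operators_compose[OF S(1)]
      by (simp add: compact_operator_def)
  qed
  show "compact_operator scaleC S"
    if refl: "reflexive_space (scaleC :: complex \<Rightarrow> 'b complexification \<Rightarrow> 'b complexification)"
  proof -
    note c = reflexive_subseq_compact[OF reflexive_space_scaleC_imp_scaleR[OF refl] u]
    have "S = (\<lambda>z. Complexify (A (re_part z) - B (im_part z)) (B (re_part z) + A (im_part z)))"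
      using S_eq by blast
    moreover have "subseq_compact_map \<dots>"
      by (intro combine parts[OF c] A B)
    ultimately show ?thesis
      using subseq_compact_map_imp_compact[of S] S(1) by (simp add: compact_operator_def)
  qed
qed

end
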